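(* Fix $N\ge 1$, $\Lambda\ge 1$, $\beta\in(0,1]$ and $\alpha=1-\beta$. There exist $k>1$ and $C,\varepsilon_0>0$, depending only on $N,\Lambda,\alpha,\beta$, and for every $\theta>0$ there exists $\eta=\eta(\theta)>0$ (depending only on $\theta,N,\Lambda,\alpha,\beta$), such that the following holds. Let $R>0$, $0<\varepsilon<\varepsilon_0R$, $m,M\in\mathbb{R}$, let $\nu$ be an admissible family, let $f:B_{kR}\to\mathbb{R}$ be bounded and Borel measurable, and let $u:\mathbb{R}^N\to\mathbb{R}$ be a bounded Borel measurable function such that $$u(x)\le\alpha\int u(x+\varepsilon z)\,d\nu_x(z)+\frac{\beta}{|B_\varepsilon|}\int_{B_\varepsilon(x)}u(y)\,dy+\varepsilon^2f(x)\qquad\text{for every }x\in B_{kR}.$$ If $u\le M$ in $B_{kR}$ and $|B_R\cap\{u\le m\}|\ge\theta|B_R|$, then $$\sup_{B_R}u\le(1-\eta)M+\eta m+CR^2\|f\|_\infty.$$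
   Context: $B_r(x)=\{y\in\mathbb{R}^N:|x-y|<r\}$, $B_r=B_r(0)$, $|E|$ is Lebesgue measure, and $\|f\|_\infty$ is the supremum of $|f|$. Let $\mathcal{M}(B_\Lambda)$ be the set of Radon probability measures on $\mathbb{R}^N$ with support in $B_\Lambda$ that are symmetric ($\nu(E)=\nu(-E)$ for all measurable $E$). An admissible family is a map $\nu:\mathbb{R}^N\to\mathcal{M}(B_\Lambda)$, $x\mapsto\nu_x$, such that $x\mapsto\int u(x+z)\,d\nu_x(z)$ is Borel measurable for every Borel measurable $u$ (for which these integrals are defined). *)

theory Defs
  imports "HOL-Probability.Probability"
begin

text \<open>
  On a Euclidean space the regularity requirement is redundant for finite Borel measures
  (theorem \<open>inner_regular\<close> of \<open>HOL-Analysis.Regularity\<close>); it is kept so that the definition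
  is the usual one.
\<close>

definition radon_measure :: "'a::topological_space measure \<Rightarrow> bool" where
  "radon_measure \<mu> \<longleftrightarrow>
     sets \<mu> = sets borel \<and>
     (\<forall>K. compact K \<longrightarrow> emeasure \<mu> K < \<infinity>) \<and>
     (\<forall>E\<in>sets borel. emeasure \<mu> E = (SUP K\<in>{K. compact K \<and> K \<subseteq> E}. emeasure \<mu> K))"

definition measure_support :: "'a::topological_space measure \<Rightarrow> 'a set" where
  "measure_support \<mu> = {x. \<forall>U. open U \<and> x \<in> U \<longrightarrow> emeasure \<mu> U > 0}"

definition symmetric_measure :: "'a::{topological_space, uminus} measure \<Rightarrow> bool" where
  "symmetric_measure \<mu> \<longleftrightarrow> (\<forall>E\<in>sets \<mu>. emeasure \<mu> E = emeasure \<mu> (uminus ` E))"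

text \<open>
  The support is a closed set and is required to lie in the open ball, which is
  slightly more than the open ball having full measure.
\<close>

definition symmetric_prob_measures :: "real \<Rightarrow> (real ^ 'n) measure set" where
  "symmetric_prob_measures \<Lambda> =
     {\<mu>. radon_measure \<mu> \<and> prob_space \<mu> \<and> measure_support \<mu> \<subseteq> ball 0 \<Lambda> \<and> symmetric_measure \<mu>}"

text \<open>
  The Bochner integral of a non-integrable function is \<open>0\<close> by convention, so ``the integrals
  are defined'' is expressed by integrability at every point.
\<close>

definition admissible_family :: "real \<Rightarrow> (real ^ 'n \<Rightarrow> (real ^ 'n) measure) \<Rightarrow> bool" where
  "admissible_family \<Lambda> \<nu> \<longleftrightarrow>
     (\<forall>x. \<nu> x \<in> symmetric_prob_measures \<Lambda>) \<and>
     (\<forall>u :: real ^ 'n \<Rightarrow> real. u \<in> borel_measurable borel \<longrightarrow>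
        (\<forall>x. integrable (\<nu> x) (\<lambda>z. u (x + z))) \<longrightarrow>
        (\<lambda>x. \<integral>z. u (x + z) \<partial>\<nu> x) \<in> borel_measurable borel)"

end

theory Submission
  imports Defs
begin

text \<open>
  After rescaling to \<open>\<epsilon> = 1\<close>, the function \<open>v = (M - u) / (M - m)\<close> is a nonnegative supersolution, up to a
  small constant error, of the averaging operator with kernels \<open>\<nu> x\<close> and the uniform measure on the
  unit ball, and the claim is that \<open>{v \<ge> 1}\<close> having density \<open>\<theta>\<close> forces a lower bound on \<open>v\<close>.

  Instead of the ABP estimate with convex envelopes, paraboloids of opening \<open>a\<close> and varying vertex are slid
  up to a near-contact with \<open>v\<close> (Savin, Cabre). At a contact point the supersolution property and
  Markov's inequality keep \<open>v\<close> within \<open>O(a)\<close> of the paraboloid on most of the unit ball around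
  it. This bounds the set of vertices sharing nearby contact points, so there are many well separated
  contact points, and around each of them \<open>v\<close> is bounded on a set of definite measure. Contrapositively,
  \<open>v \<ge> 1\<close> on all but a small fraction of a cube gives a lower bound near its centre. A Gaussian
  barrier spreads this bound to the parent cube, and the uniform part of the kernel does so for cubes of
  bounded size. A Calderon--Zygmund argument then makes \<open>|{v \<ge> d ^ j}|\<close> grow geometrically in \<open>j\<close> until
  the set fills almost the whole cube, after a number of steps depending only on \<open>\<theta>\<close>.
\<close>

section \<open>Centred kernels and supersolutions\<close>

text \<open>The kernels \<open>\<nu> x\<close> may be degenerate (Dirac masses at the origin, say)
  and may change abruptly with x. They are therefore used only through lower bounds, and all
  regularisation comes from the uniform part with its weight \<beta>. That part acts at unit length
  and says nothing below it: v may be discontinuous, infima may fail to be attained, and contact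
  points are meaningful only up to a distance of order one. So near-infima with a quantified slack
  replace minima, a count of separated contact points replaces an area formula for the map from
  vertices to contact points, and the dyadic decomposition stops at cubes small enough to be seen by
  a single uniform average.

  The error g grows relative to v each time v is renormalised. Since the number of renormalisations
  is fixed by \<theta> in advance, an error of size at most \<kappa> * \<eta> / R^2 is tolerable,
  with \<kappa> independent of \<theta>.\<close>

abbreviation unif :: "'a::euclidean_space measure" where
  "unif \<equiv> uniform_measure lborel (ball 0 1)"

text \<open>Symmetry enters as vanishing first moments: an affine function integrates to its value
  at the origin. The support condition becomes an almost sure bound on the jump length.\<close>

definition centred :: "real \<Rightarrow> 'a::euclidean_space measure \<Rightarrow> bool" where
  "centred \<Lambda> \<mu> \<longleftrightarrow> prob_space \<mu> \<and> sets \<mu> = sets borel \<and> (AE z in \<mu>. norm z < \<Lambda>) \<and>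
     (\<forall>q. (\<integral>z. q \<bullet> z \<partial>\<mu>) = 0)"

text \<open>Boundedness on the whole space guarantees that every kernel integral is a genuine one
  and not the default value 0. The inequality itself is local to D.\<close>

definition supersolution ::
  "real \<Rightarrow> real \<Rightarrow> ('a::euclidean_space \<Rightarrow> 'a measure) \<Rightarrow> real \<Rightarrow> 'a set \<Rightarrow> ('a \<Rightarrow> real) \<Rightarrow> bool" where
  "supersolution \<alpha> \<beta> \<nu> g D v \<longleftrightarrow> v \<in> borel_measurable borel \<and> bounded (range v) \<and>
     (\<forall>x\<in>D. \<alpha> * (\<integral>z. v (x + z) \<partial>\<nu> x) + \<beta> * (\<integral>z. v (x + z) \<partial>unif) - g \<le> v x)"

section \<open>The uniform measure on the unit ball\<close>

lemma content_ball_1_pos [simp]: "0 < measure lborel (ball (0::'a::euclidean_space) 1)"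
  by (simp add: content_ball_pos)

lemma distr_uminus_lborel: "distr lborel borel uminus = (lborel :: 'a::euclidean_space measure)"
proof -
  have "lborel = density (distr lborel borel (\<lambda>x::'a. 0 + (-1) *\<^sub>R x)) (\<lambda>_. \<bar>-1::real\<bar> ^ DIM('a))"
    by (rule lborel_affine) simp
  then show ?thesis
    by (simp add: density_1)
qed

lemma integral_inner_eq_0:
  fixes \<mu> :: "'a::euclidean_space measure"
  assumes "sets \<mu> = sets borel" "distr \<mu> borel uminus = \<mu>"
  shows "(\<integral>z. q \<bullet> z \<partial>\<mu>) = 0"
proof -
  have [measurable_cong]: "sets \<mu> = sets borel" by fact
  have "(\<integral>z. q \<bullet> z \<partial>\<mu>) = (\<integral>z. q \<bullet> z \<partial>(distr \<mu> borel uminus))"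
    using assms by simp
  also have "\<dots> = (\<integral>z. q \<bullet> (- z) \<partial>\<mu>)"
    by (rule integral_distr) (auto intro: measurable_compose)
  also have "\<dots> = - (\<integral>z. q \<bullet> z \<partial>\<mu>)"
    by simp
  finally show ?thesis by simp
qed

lemma prob_space_unif: "prob_space (unif :: 'a::euclidean_space measure)"
  using emeasure_lborel_ball_finite[of "0::'a" 1] content_ball_1_pos[where 'a='a]
  by (intro prob_space_uniform_measure) (auto simp: measure_def)

lemma measure_unif:
  assumes "B \<in> sets borel"
  shows "measure (unif :: 'a::euclidean_space measure) B =
    measure lborel (ball 0 1 \<inter> B) / measure lborel (ball (0::'a) 1)"
  using emeasure_lborel_ball_finite[of "0::'a" 1] content_ball_1_pos[where 'a='a] assms
  by (intro measure_uniform_measure) (auto simp: measure_def)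

lemma measure_unif_ball:
  assumes "0 \<le> r" "norm c + r \<le> 1"
  shows "measure (unif :: 'a::euclidean_space measure) (ball c r) = r ^ DIM('a)"
proof -
  have "ball c r \<subseteq> ball 0 1"
    using assms by (simp add: ball_subset_ball_iff dist_norm)
  then have "ball 0 1 \<inter> ball c r = ball c r" by blast
  then show ?thesis
    using content_ball_1_pos[where 'a='a] content_ball_conv_unit_ball[OF assms(1), of c]
    by (simp add: measure_unif)
qed

lemma centred_unif:
  assumes "1 \<le> \<Lambda>"
  shows "centred \<Lambda> (unif :: 'a::euclidean_space measure)"
proof -
  have fin: "emeasure lborel (ball (0::'a) 1) \<noteq> 0" "emeasure lborel (ball (0::'a) 1) < \<infinity>"
    using emeasure_lborel_ball_finite[of "0::'a" 1] content_ball_1_pos[where 'a='a]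
    by (auto simp: measure_def)
  have "distr (unif :: 'a measure) borel uminus = unif"
  proof (rule measure_eqI)
    fix A :: "'a set" assume "A \<in> sets (distr unif borel uminus)"
    then have A [measurable]: "A \<in> sets borel" by simp
    have [measurable]: "uminus -` A \<in> sets borel"
      using measurable_sets_borel[of uminus borel A] by simp
    have "emeasure lborel (ball 0 1 \<inter> uminus -` A) = emeasure lborel (uminus -` (ball 0 1 \<inter> A))"
      by (rule arg_cong[where f="emeasure lborel"]) auto
    also have "\<dots> = emeasure (distr lborel borel uminus) (ball 0 1 \<inter> A)"
      by (subst emeasure_distr) auto
    finally have "emeasure lborel (ball 0 1 \<inter> uminus -` A) = emeasure lborel (ball 0 1 \<inter> A)"
      by (simp add: distr_uminus_lborel)
    then show "emeasure (distr unif borel uminus) A = emeasure unif A"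
      by (simp add: emeasure_distr)
  qed simp
  moreover have "AE z in (unif :: 'a measure). norm z < \<Lambda>"
    using assms by (subst AE_uniform_measure[OF fin]) auto
  ultimately show ?thesis
    using prob_space_unif integral_inner_eq_0[of unif] by (auto simp: centred_def)
qed

section \<open>Integration against centred kernels\<close>

lemma centred_integrable:
  fixes f :: "'a::euclidean_space \<Rightarrow> real"
  assumes "centred \<Lambda> \<mu>" "f \<in> borel_measurable borel" "\<And>z. norm z < \<Lambda> \<Longrightarrow> \<bar>f z\<bar> \<le> B"
  shows "integrable \<mu> f"
proof -
  interpret prob_space \<mu> using assms by (simp add: centred_def)
  have [measurable_cong]: "sets \<mu> = sets borel" using assms by (simp add: centred_def)
  note assms(2)[measurable]
  show ?thesis
    using assms(1,3) by (intro integrable_const_bound[where B=B]) (auto simp: centred_def)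
qed

lemma centred_inner_integrable:
  fixes q :: "'a::euclidean_space"
  assumes "centred \<Lambda> \<mu>"
  shows "integrable \<mu> (\<lambda>z. q \<bullet> z)"
proof (rule centred_integrable[OF assms, where B="norm q * \<Lambda>"])
  fix z :: 'a assume "norm z < \<Lambda>"
  then show "\<bar>q \<bullet> z\<bar> \<le> norm q * \<Lambda>"
    by (meson Cauchy_Schwarz_ineq2 less_imp_le mult_left_mono norm_ge_zero order_trans)
qed simp

lemma centred_integral_mono:
  fixes \<phi> f :: "'a::euclidean_space \<Rightarrow> real"
  assumes "centred \<Lambda> \<mu>" "integrable \<mu> \<phi>" "integrable \<mu> f"
    "\<And>z. norm z < \<Lambda> \<Longrightarrow> \<phi> z \<le> f z"
  shows "(\<integral>z. \<phi> z \<partial>\<mu>) \<le> (\<integral>z. f z \<partial>\<mu>)"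
  using assms by (intro integral_mono_AE) (auto simp: centred_def elim!: eventually_mono)

text \<open>This is how a kernel of unknown shape is bounded from below: an affine minorant on the
  ball of radius \<Lambda> contributes its constant term, because its linear part has mean
  zero.\<close>

lemma centred_integral_affine_ge:
  fixes f :: "'a::euclidean_space \<Rightarrow> real"
  assumes "centred \<Lambda> \<mu>" "integrable \<mu> f" "\<And>z. norm z < \<Lambda> \<Longrightarrow> c + q \<bullet> z \<le> f z"
  shows "c \<le> (\<integral>z. f z \<partial>\<mu>)"
proof -
  interpret prob_space \<mu> using assms by (simp add: centred_def)
  have "(\<integral>z. c + q \<bullet> z \<partial>\<mu>) \<le> (\<integral>z. f z \<partial>\<mu>)"
    using assms centred_inner_integrable[OF assms(1)]
    by (intro centred_integral_mono[OF assms(1)]) auto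
  moreover have "(\<integral>z. c + q \<bullet> z \<partial>\<mu>) = c"
    using assms(1) centred_inner_integrable[OF assms(1), of q]
    by (subst Bochner_Integration.integral_add) (auto simp: centred_def prob_space)
  ultimately show ?thesis by simp
qed

lemma bounded_translate_integrable:
  fixes v :: "'a::euclidean_space \<Rightarrow> real"
  assumes "centred \<Lambda> \<mu>" "v \<in> borel_measurable borel" "bounded (range v)"
  shows "integrable \<mu> (\<lambda>z. v (x + z))"
proof -
  note assms(2)[measurable]
  obtain B where "\<And>x. \<bar>v x\<bar> \<le> B"
    using assms(3) by (auto simp: bounded_iff)
  then show ?thesis
    by (intro centred_integrable[OF assms(1)]) auto
qed

lemma supersolution_integrable:
  assumes "supersolution \<alpha> \<beta> \<nu> g D v" "centred \<Lambda> \<mu>"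
  shows "integrable \<mu> (\<lambda>z. v (x + z))"
  using assms by (auto simp: supersolution_def intro: bounded_translate_integrable)

lemma supersolution_subset:
  "supersolution \<alpha> \<beta> \<nu> g D v \<Longrightarrow> D' \<subseteq> D \<Longrightarrow> supersolution \<alpha> \<beta> \<nu> g D' v"
  by (auto simp: supersolution_def)

lemma supersolution_scale:
  assumes "supersolution \<alpha> \<beta> \<nu> g D v" "0 < c"
  shows "supersolution \<alpha> \<beta> \<nu> (c * g) D (\<lambda>x. c * v x)"
proof -
  have "bounded (range (\<lambda>x. c * v x))"
    using assms(1) bounded_scaling[of "range v" c] by (simp add: supersolution_def image_image)
  moreover have "\<alpha> * (\<integral>z. c * v (x + z) \<partial>\<nu> x) + \<beta> * (\<integral>z. c * v (x + z) \<partial>unif) - c * g \<le> c * v x"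
    if "x \<in> D" for x
  proof -
    have "c * (\<alpha> * (\<integral>z. v (x + z) \<partial>\<nu> x) + \<beta> * (\<integral>z. v (x + z) \<partial>unif) - g) \<le> c * v x"
      using assms that by (auto simp: supersolution_def)
    then show ?thesis by (simp add: algebra_simps)
  qed
  ultimately show ?thesis
    using assms by (auto simp: supersolution_def)
qed

section \<open>Contact points of paraboloids\<close>

lemma measure_unif_vimage_plus:
  fixes x :: "'a::euclidean_space"
  assumes [measurable]: "S \<in> sets borel" and "S \<subseteq> ball x 1"
  shows "measure unif ((+) x -` S) = measure lborel S / measure lborel (ball (0::'a) 1)"
proof -
  have [measurable]: "(+) x -` S \<in> sets borel"
    using measurable_sets_borel[of "(+) x" borel S] by simp
  have "(+) x -` S \<subseteq> ball 0 1"
    using assms(2) by (force simp: dist_norm)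
  then have "ball 0 1 \<inter> (+) x -` S = (+) x -` S" by blast
  moreover have "measure lborel ((+) x -` S) = measure (distr lborel borel ((+) x)) S"
    by (subst measure_distr) auto
  ultimately show ?thesis
    by (simp add: measure_unif lborel_distr_plus)
qed

text \<open>The touching paraboloid bounds the \<open>\<nu> x\<close> average from below by v x up
  to O(a), so the supersolution inequality leaves only O(a) / \<beta> for the mean excess of v over
  the tangent plane in the uniform average. Markov's inequality turns this mean into a measure
  estimate, whence the constant 3 * \<Lambda>^2 / (\<beta> * \<delta>).\<close>

lemma contact_excess_small:
  fixes v :: "'a::euclidean_space \<Rightarrow> real"
  assumes \<Lambda>: "1 \<le> \<Lambda>" and \<beta>: "0 < \<beta>" "\<beta> \<le> 1"
    and cen: "centred \<Lambda> (\<nu> x)" and sup: "supersolution (1 - \<beta>) \<beta> \<nu> g D v" and x: "x \<in> D"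
    and a: "0 < a" "g \<le> a"
    and touch: "\<And>z. norm z < \<Lambda> \<Longrightarrow> v x + q \<bullet> z - a / 2 * (norm z)\<^sup>2 - a \<le> v (x + z)"
    and \<delta>: "0 < \<delta>"
  shows "measure unif {z. v x + q \<bullet> z + a * (3 * \<Lambda>\<^sup>2 / (\<beta> * \<delta>)) \<le> v (x + z)} \<le> \<delta>"
proof -
  note int = supersolution_integrable[OF sup]
  have [measurable]: "v \<in> borel_measurable borel" using sup by (simp add: supersolution_def)
  have cenU: "centred 1 (unif :: 'a measure)" by (rule centred_unif) simp
  interpret U: prob_space "unif :: 'a measure" by (rule prob_space_unif)
  \<comment> \<open>The shift 3 / 2 * a covers the quadratic term, at most a / 2 on the unit ball,
    and the slack a; it makes h nonnegative there, as Markov's inequality requires.\<close>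
  define h where "h z = v (x + z) - v x - q \<bullet> z + 3 / 2 * a" for z
  have h_int: "integrable unif h"
    unfolding h_def using int[OF cenU] centred_inner_integrable[OF cenU] by auto
  have h_nn: "0 \<le> h z" if "norm z < 1" for z
  proof -
    have "a / 2 * (norm z)\<^sup>2 \<le> a / 2"
      using that a by (simp add: power_le_one_iff mult_left_le)
    then show ?thesis using touch[of z] that \<Lambda> by (simp add: h_def)
  qed
  have "(v x - a / 2 * \<Lambda>\<^sup>2 - a) \<le> (\<integral>z. v (x + z) \<partial>\<nu> x)"
  proof (rule centred_integral_affine_ge[OF cen int[OF cen]])
    fix z :: 'a assume z: "norm z < \<Lambda>"
    have "a / 2 * (norm z)\<^sup>2 \<le> a / 2 * \<Lambda>\<^sup>2"
      using z a by (intro mult_left_mono power_mono) auto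
    then show "v x - a / 2 * \<Lambda>\<^sup>2 - a + q \<bullet> z \<le> v (x + z)"
      using touch[OF z] by simp
  qed
  then have 1: "(1 - \<beta>) * (v x - a / 2 * \<Lambda>\<^sup>2 - a) \<le> (1 - \<beta>) * (\<integral>z. v (x + z) \<partial>\<nu> x)"
    using \<beta> by (intro mult_left_mono) auto
  have "(\<integral>z. q \<bullet> z \<partial>(unif :: 'a measure)) = 0"
    using cenU by (simp add: centred_def)
  then have "(\<integral>z. h z \<partial>unif) = (\<integral>z. v (x + z) \<partial>unif) - v x + 3 / 2 * a"
    unfolding h_def using int[OF cenU] centred_inner_integrable[OF cenU, of q]
    by (simp add: U.prob_space[simplified])
  then have "(\<integral>z. v (x + z) \<partial>unif) = (\<integral>z. h z \<partial>unif) + v x - 3 / 2 * a"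
    by simp
  then have 2: "\<beta> * (\<integral>z. v (x + z) \<partial>unif) = \<beta> * (\<integral>z. h z \<partial>unif) + \<beta> * v x - \<beta> * (3 / 2 * a)"
    by (simp only: distrib_left right_diff_distrib)
  have 3: "(1 - \<beta>) * (\<integral>z. v (x + z) \<partial>\<nu> x) + \<beta> * (\<integral>z. v (x + z) \<partial>unif) - g \<le> v x"
    using sup x by (simp add: supersolution_def)
  have "\<beta> * (\<integral>z. h z \<partial>unif) \<le> g + (1 - \<beta>) * (a / 2 * \<Lambda>\<^sup>2 + a) + \<beta> * (3 / 2 * a)"
    using 1 2 3 by (simp add: algebra_simps)
  also have "\<dots> \<le> a + (1 - \<beta>) * (2 * a * \<Lambda>\<^sup>2) + \<beta> * (2 * a * \<Lambda>\<^sup>2)"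
  proof -
    have "1 \<le> \<Lambda>\<^sup>2" using \<Lambda> by simp
    then obtain T where T: "a * \<Lambda>\<^sup>2 = T" "a \<le> T" using a by auto
    then have "a / 2 * \<Lambda>\<^sup>2 + a = T / 2 + a" "2 * a * \<Lambda>\<^sup>2 = 2 * T" by auto
    then have le: "a / 2 * \<Lambda>\<^sup>2 + a \<le> 2 * a * \<Lambda>\<^sup>2" "3 / 2 * a \<le> 2 * a * \<Lambda>\<^sup>2"
      using a T(2) by linarith+
    show ?thesis by (intro add_mono mult_left_mono le) (use a \<beta> in simp_all)
  qed
  also have "\<dots> \<le> 3 * a * \<Lambda>\<^sup>2"
  proof -
    have "1 \<le> \<Lambda>\<^sup>2" using \<Lambda> by simp
    then have "a \<le> a * \<Lambda>\<^sup>2" using a by simp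
    then show ?thesis by (simp add: algebra_simps)
  qed
  finally have 4: "(\<integral>z. h z \<partial>unif) \<le> 3 * a * \<Lambda>\<^sup>2 / \<beta>"
    using \<beta> by (simp add: field_simps)
  define c where "c = a * (3 * \<Lambda>\<^sup>2 / (\<beta> * \<delta>))"
  have c: "0 < c" using a \<Lambda> \<beta> \<delta> by (simp add: c_def)
  have "measure unif {z. v x + q \<bullet> z + c \<le> v (x + z)} \<le> measure unif {z \<in> space unif. c \<le> h z}"
    using a by (intro U.finite_measure_mono) (auto simp: h_def)
  also have "\<dots> \<le> (\<integral>z. h z \<partial>unif) / c"
    using h_int c
  proof (intro integral_Markov_inequality_measure[where A="{}"])
    show "AE z in unif. 0 \<le> h z"
      using cenU h_nn by (auto simp: centred_def elim!: eventually_mono)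
  qed auto
  also have "\<dots> \<le> (3 * a * \<Lambda>\<^sup>2 / \<beta>) / c"
    using 4 c by (intro divide_right_mono) auto
  also have "\<dots> = \<delta>"
    using a \<Lambda> \<beta> \<delta> by (simp add: c_def field_simps)
  finally show ?thesis by (simp add: c_def)
qed

text \<open>
  Two parallel supporting paraboloids with nearby contact points have nearby vertices: for most
  \<open>z\<close> the graph at \<open>x1 + z\<close> is within \<open>O(a)\<close> of the first paraboloid, while a large difference of
  slopes would lift the second one above it on a ball of fixed radius.
\<close>
lemma contact_vertices_close:
  fixes v :: "'a::euclidean_space \<Rightarrow> real"
  assumes a: "0 < a" and C: "0 \<le> C" and near: "dist x1 x2 < 1 / 4"
    and v: "v \<in> borel_measurable borel"
    and touch1: "\<And>z. norm z < 1 \<Longrightarrow> v x1 + (a *\<^sub>R (y1 - x1)) \<bullet> z - a / 2 * (norm z)\<^sup>2 - a \<le> v (x1 + z)"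
    and touch2: "\<And>z. norm z < 1 \<Longrightarrow> v x2 + (a *\<^sub>R (y2 - x2)) \<bullet> z - a / 2 * (norm z)\<^sup>2 - a \<le> v (x2 + z)"
    and bad: "measure unif {z. v x1 + (a *\<^sub>R (y1 - x1)) \<bullet> z + a * C \<le> v (x1 + z)} < (1 / 8) ^ DIM('a)"
  shows "dist y1 y2 \<le> 3 * C + 10"
proof -
  note v[measurable]
  interpret U: prob_space "unif :: 'a measure" by (rule prob_space_unif)
  define q1 q2 d where "q1 = a *\<^sub>R (y1 - x1)" and "q2 = a *\<^sub>R (y2 - x2)" and "d = q2 - q1"
  have d_bound: "norm d \<le> 3 * a * (C + 3)"
  proof (cases "d = 0")
    case False
    define e where "e = d /\<^sub>R norm d"
    have e: "norm e = 1" "d \<bullet> e = norm d"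
      using False by (simp_all add: e_def dot_square_norm power2_eq_square)
    \<comment> \<open>Seen from x1, this is the point half a unit away from x2 in the direction of
      the slope difference d. The ball of radius 1 / 8 around it lies in the unit ball, as 1 / 4 + 1
      / 2 + 1 / 8 < 1, and has uniform measure (1 / 8) ^ DIM('a), too much to be contained in the
      bad set.\<close>
    define w where "w = x2 - x1 + e /\<^sub>R 2"
    have "norm w \<le> norm (x2 - x1) + norm (e /\<^sub>R 2)"
      unfolding w_def by (rule norm_triangle_ineq)
    then have w: "norm w + 1 / 8 \<le> 1"
      using near e by (simp add: dist_norm norm_minus_commute)
    have "\<not> ball w (1 / 8) \<subseteq> {z. v x1 + q1 \<bullet> z + a * C \<le> v (x1 + z)}"
    proof
      assume "ball w (1 / 8) \<subseteq> {z. v x1 + q1 \<bullet> z + a * C \<le> v (x1 + z)}"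
      then have "measure unif (ball w (1 / 8)) \<le> measure unif {z. v x1 + q1 \<bullet> z + a * C \<le> v (x1 + z)}"
        by (intro U.finite_measure_mono) auto
      then show False
        using bad measure_unif_ball[OF _ w] by (simp add: q1_def)
    qed
    then obtain z where z: "dist w z < 1 / 8" "v (x1 + z) < v x1 + q1 \<bullet> z + a * C"
      by (metis (no_types, lifting) mem_Collect_eq mem_ball not_le subsetI)
    have z1: "norm z < 1"
      using z(1) w norm_triangle_ineq2[of z w] by (simp add: dist_norm norm_minus_commute)
    define z' where "z' = x1 + z - x2"
    have z'_e: "norm (z' - e /\<^sub>R 2) < 1 / 8"
      using z(1) by (simp add: z'_def w_def dist_norm norm_minus_commute algebra_simps)
    have z'_lt: "norm z' < 1"
      using z'_e e norm_triangle_ineq2[of z' "e /\<^sub>R 2"] by simp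
    have sq: "a / 2 * (norm z')\<^sup>2 \<le> a / 2" "a / 2 * (norm (x2 - x1))\<^sup>2 \<le> a / 2"
      using z'_lt near a by (auto simp: power_le_one_iff mult_left_le dist_norm norm_minus_commute)
    \<comment> \<open>Compare v at x1 + z and at x2 with both paraboloids. The two slacks a and the
      two quadratic terms a / 2 add up to the 3 in C + 3.\<close>
    have "v x2 + q2 \<bullet> z' - a / 2 * (norm z')\<^sup>2 - a \<le> v (x1 + z)"
      using touch2[OF z'_lt] by (simp add: q2_def z'_def)
    moreover have "v x1 + q1 \<bullet> (x2 - x1) - a / 2 * (norm (x2 - x1))\<^sup>2 - a \<le> v x2"
      using touch1[of "x2 - x1"] near by (simp add: q1_def dist_norm norm_minus_commute)
    moreover have "q1 \<bullet> z = q1 \<bullet> (x2 - x1) + q1 \<bullet> z'"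
      by (simp add: z'_def inner_add_right inner_diff_right)
    ultimately have "d \<bullet> z' \<le> a * (C + 3)"
      using z(2) sq by (simp add: d_def inner_diff_left algebra_simps)
    moreover have "3 / 8 * norm d \<le> d \<bullet> z'"
    proof -
      have "\<bar>d \<bullet> (z' - e /\<^sub>R 2)\<bar> \<le> norm d * norm (z' - e /\<^sub>R 2)"
        by (rule Cauchy_Schwarz_ineq2)
      also have "\<dots> \<le> norm d * (1 / 8)"
        using z'_e by (intro mult_left_mono) auto
      finally have "\<bar>d \<bullet> (z' - e /\<^sub>R 2)\<bar> \<le> norm d * (1 / 8)" .
      moreover have "d \<bullet> (z' - e /\<^sub>R 2) = d \<bullet> z' - norm d / 2"
        using e by (simp add: inner_diff_right)
      ultimately show ?thesis by linarith
    qed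
    ultimately have "3 / 8 * norm d \<le> a * (C + 3)" by simp
    moreover have "0 \<le> a * (C + 3)" using a C by simp
    ultimately show ?thesis by simp
  qed (use a C in simp)
  \<comment> \<open>Slopes have the form a * (y - x), so vertices differ by the slope difference
    divided by a plus the displacement of the contact points.\<close>
  have "a *\<^sub>R (y2 - y1) = d + a *\<^sub>R (x2 - x1)"
    by (simp add: d_def q1_def q2_def algebra_simps)
  then have "norm (a *\<^sub>R (y2 - y1)) \<le> norm d + norm (a *\<^sub>R (x2 - x1))"
    by (metis norm_triangle_ineq)
  then have "a * norm (y2 - y1) \<le> norm d + a * norm (x2 - x1)"
    using a by simp
  also have "\<dots> \<le> 3 * a * (C + 3) + a * (1 / 4)"
    using d_bound near a by (intro add_mono mult_left_mono) (auto simp: dist_norm norm_minus_commute)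
  also have "\<dots> \<le> a * (3 * C + 10)"
    using a by (simp add: algebra_simps)
  finally show ?thesis
    using a by (simp add: dist_norm norm_minus_commute)
qed

lemma bounded_borel_fmeasurable:
  fixes S :: "'a::euclidean_space set"
  assumes "S \<in> sets borel" "bounded S"
  shows "S \<in> fmeasurable lborel"
  using assms emeasure_bounded_finite[of S] by (intro fmeasurableI) auto

text \<open>
  With this opening \<open>a\<close>, the value at \<open>x0\<close> forces the near-minimisers of \<open>v x + a / 2 * (dist x y)\<^sup>2\<close>
  into \<open>ball x0 (r / 2)\<close>. The slack \<open>a\<close> in the minimisation
  replaces the existence of a minimum, which may fail for a merely measurable function.
\<close>
lemma near_contact_exists:
  fixes v :: "'a::euclidean_space \<Rightarrow> real"
  assumes r: "8 \<le> r" and nn: "\<And>x. x \<in> ball x0 (2 * r) \<Longrightarrow> 0 \<le> v x" and v0: "v x0 \<le> 1"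
    and y: "y \<in> ball x0 (r / 8)" and a: "a = 32 / r\<^sup>2"
  shows "\<exists>x\<in>ball x0 (r / 2). v x \<le> 2 \<and>
    (\<forall>x'\<in>ball x0 (2 * r). v x + (a *\<^sub>R (y - x)) \<bullet> (x' - x) - a / 2 * (norm (x' - x))\<^sup>2 - a \<le> v x')"
proof -
  have r2: "64 \<le> r\<^sup>2" using power_mono[of 8 r 2] r by simp
  have a0: "0 < a" and ar: "a * r\<^sup>2 = 32" using a r by auto
  have "a \<le> 32 / 64" unfolding a using r2 by (intro divide_left_mono) auto
  with a0 have a0: "0 < a" "a \<le> 1 / 2" by auto
  define w where "w x = v x + a / 2 * (dist x y)\<^sup>2" for x
  define I where "I = (INF x\<in>ball x0 (2 * r). w x)"
  have bdd: "bdd_below (w ` ball x0 (2 * r))"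
    using nn a0 by (intro bdd_belowI[where m=0]) (auto simp: w_def)
  have x0: "x0 \<in> ball x0 (2 * r)" using r by simp
  have I_le: "I \<le> w x'" if "x' \<in> ball x0 (2 * r)" for x'
    unfolding I_def using bdd that by (rule cINF_lower)
  have "Inf (w ` ball x0 (2 * r)) < I + a"
    using a0 by (simp add: I_def)
  then obtain x where x: "x \<in> ball x0 (2 * r)" "w x < I + a"
    using x0 by (subst (asm) cInf_less_iff) (use bdd in auto)
  \<comment> \<open>The constant 32 separates two values: the penalty is at most 1 / 4 at x0, so w x
    < 1 + 1 / 4 + a \<le> 7 / 4, whereas a point at distance r / 2 or more from x0 is at least 3 / 8
    * r away from y and has penalty at least 9 / 4.\<close>
  have "(dist x0 y)\<^sup>2 \<le> (r / 8)\<^sup>2"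
    using y by (intro power_mono) auto
  then have "a / 2 * (dist x0 y)\<^sup>2 \<le> a / 2 * (r / 8)\<^sup>2"
    using a0 by (intro mult_left_mono) auto
  also have "\<dots> = 1 / 4"
    using ar by (simp add: power_divide)
  finally have wx: "w x < 7 / 4"
    using x(2) I_le[OF x0] v0 a0 by (simp add: w_def)
  have "dist x0 x < r / 2"
  proof (rule ccontr)
    assume "\<not> dist x0 x < r / 2"
    then have "3 / 8 * r \<le> dist x y"
      using y dist_triangle[of x0 x y] by (simp add: dist_commute)
    then have "(3 / 8 * r)\<^sup>2 \<le> (dist x y)\<^sup>2"
      using r by (intro power_mono) auto
    then have "a / 2 * (3 / 8 * r)\<^sup>2 \<le> a / 2 * (dist x y)\<^sup>2"
      using a0 by (intro mult_left_mono) auto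
    moreover have "a / 2 * (3 / 8 * r)\<^sup>2 = 9 / 4"
      using ar by (simp add: power_mult_distrib power_divide)
    ultimately show False
      using wx nn[OF x(1)] by (simp add: w_def)
  qed
  moreover have "v x \<le> 2"
  proof -
    have "0 \<le> a / 2 * (dist x y)\<^sup>2" using a0 by simp
    then show ?thesis using wx unfolding w_def by linarith
  qed
  moreover have "v x + (a *\<^sub>R (y - x)) \<bullet> (x' - x) - a / 2 * (norm (x' - x))\<^sup>2 - a \<le> v x'"
    if "x' \<in> ball x0 (2 * r)" for x'
  proof -
    obtain p where p: "p = (x' - x) \<bullet> (x - y)" by simp
    have 1: "(dist x' y)\<^sup>2 = (norm (x' - x))\<^sup>2 + 2 * p + (dist x y)\<^sup>2"
      unfolding dist_norm power2_norm_eq_inner p by (simp add: algebra_simps inner_commute)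
    have 2: "(y - x) \<bullet> (x' - x) = - p"
      by (simp add: p algebra_simps inner_commute)
    have "w x - a \<le> w x'"
      using I_le[OF that] x(2) by simp
    then show ?thesis
      by (simp add: w_def 1 2 distrib_left)
  qed
  ultimately show ?thesis by auto
qed

text \<open>A counting substitute for the area formula: vertices whose contact points are within 1 /
  4 of each other lie in a ball of fixed radius, so covering the vertex ball of radius r / 8 takes
  at least of order r ^ DIM('a) separated contact points, and each carries a fixed measure of low
  values. Only cardinalities enter, so an arbitrary choice X of contact points will do.\<close>

lemma contact_density:
  fixes \<Lambda> \<beta> :: real
  assumes \<Lambda>: "1 \<le> \<Lambda>" and \<beta>: "0 < \<beta>" "\<beta> \<le> 1"
  shows "\<exists>K\<ge>1. \<exists>\<mu>>0. \<forall>(\<nu> :: 'a::euclidean_space \<Rightarrow> 'a measure) g v x0 r.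
    (\<forall>x. centred \<Lambda> (\<nu> x)) \<longrightarrow> 8 * \<Lambda> \<le> r \<longrightarrow> g \<le> 1 / r\<^sup>2 \<longrightarrow>
    supersolution (1 - \<beta>) \<beta> \<nu> g (ball x0 r) v \<longrightarrow> (\<forall>x\<in>ball x0 (2 * r). 0 \<le> v x) \<longrightarrow> v x0 \<le> 1 \<longrightarrow>
    \<mu> * r ^ DIM('a) \<le> measure lborel ({x. v x \<le> K} \<inter> ball x0 r)"
proof -
  define N where "N = DIM('a)"
  \<comment> \<open>Half the uniform measure of a ball of radius 1 / 20, so that the bad set fills
    at most half of such a ball; it is also below the threshold (1 / 8) ^ N of
    \<open>contact_vertices_close\<close>.\<close>
  define \<delta> :: real where "\<delta> = (1 / 20) ^ N / 2"
  define C2 where "C2 = 3 * \<Lambda>\<^sup>2 / (\<beta> * \<delta>)"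
  define \<omega> where "\<omega> = measure lborel (ball (0::'a) 1)"
  define \<mu> where "\<mu> = \<omega> * \<delta> * (1 / 8) ^ N / (3 * C2 + 11) ^ N"
  have "(1 / 20) ^ N \<le> (1 / 8 :: real) ^ N" "0 < (1 / 8 :: real) ^ N"
    by (auto intro: power_mono)
  then have "\<delta> < (1 / 8) ^ N"
    unfolding \<delta>_def by linarith
  then have \<delta>: "0 < \<delta>" "\<delta> < (1 / 8) ^ N"
    by (simp_all add: \<delta>_def)
  have C2: "0 < C2" using \<Lambda> \<beta> \<delta> by (simp add: C2_def)
  have \<omega>: "0 < \<omega>" by (simp add: \<omega>_def)
  have \<mu>: "0 < \<mu>" using C2 \<delta> \<omega> by (simp add: \<mu>_def)
  have "\<mu> * r ^ N \<le> measure lborel ({x. v x \<le> 6 + C2} \<inter> ball x0 r)"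
    if cen: "\<And>x. centred \<Lambda> (\<nu> x)" and r: "8 * \<Lambda> \<le> r" and g: "g \<le> 1 / r\<^sup>2"
      and sup: "supersolution (1 - \<beta>) \<beta> \<nu> g (ball x0 r) v"
      and nn: "\<And>x. x \<in> ball x0 (2 * r) \<Longrightarrow> 0 \<le> v x" and v0: "v x0 \<le> 1"
    for \<nu> :: "'a \<Rightarrow> 'a measure" and g v x0 r
  proof -
    interpret U: prob_space "unif :: 'a measure" by (rule prob_space_unif)
    have [measurable]: "v \<in> borel_measurable borel" using sup by (simp add: supersolution_def)
    have r8: "8 \<le> r" using r \<Lambda> by simp
    define a where "a = 32 / r\<^sup>2"
    have "64 \<le> r\<^sup>2" using power_mono[of 8 r 2] r8 by simp
    then have "a \<le> 32 / 64" unfolding a_def by (intro divide_left_mono) auto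
    moreover have "1 / r\<^sup>2 \<le> a" unfolding a_def by (intro divide_right_mono) auto
    ultimately have a0: "0 < a" "a \<le> 1 / 2" and ar: "a * r = 32 / r" and ga: "g \<le> a"
      using g r8 by (auto simp: a_def power2_eq_square)
    have "\<forall>y\<in>ball x0 (r / 8). \<exists>x\<in>ball x0 (r / 2). v x \<le> 2 \<and>
      (\<forall>x'\<in>ball x0 (2 * r). v x + (a *\<^sub>R (y - x)) \<bullet> (x' - x) - a / 2 * (norm (x' - x))\<^sup>2 - a \<le> v x')"
      by (intro ballI near_contact_exists r8 nn v0 a_def)
    then obtain X where X: "\<And>y. y \<in> ball x0 (r / 8) \<Longrightarrow> X y \<in> ball x0 (r / 2)"
      "\<And>y. y \<in> ball x0 (r / 8) \<Longrightarrow> v (X y) \<le> 2"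
      and touch: "\<And>y x'. y \<in> ball x0 (r / 8) \<Longrightarrow> x' \<in> ball x0 (2 * r) \<Longrightarrow>
        v (X y) + (a *\<^sub>R (y - X y)) \<bullet> (x' - X y) - a / 2 * (norm (x' - X y))\<^sup>2 - a \<le> v x'"
      by metis
    have touch': "v (X y) + (a *\<^sub>R (y - X y)) \<bullet> z - a / 2 * (norm z)\<^sup>2 - a \<le> v (X y + z)"
      if "y \<in> ball x0 (r / 8)" "norm z < \<Lambda>" for y z
    proof -
      have "dist x0 (X y + z) \<le> dist x0 (X y) + norm z"
        using dist_triangle[of x0 "X y + z" "X y"] by (simp add: dist_norm)
      then have "X y + z \<in> ball x0 (2 * r)"
        using X(1)[OF that(1)] that(2) r \<Lambda> by simp
      from touch[OF that(1) this] show ?thesis by simp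
    qed
    define bad where "bad y = {z. v (X y) + (a *\<^sub>R (y - X y)) \<bullet> z + a * C2 \<le> v (X y + z)}" for y
    have bad_sets [measurable]: "bad y \<in> sets borel" for y
      unfolding bad_def by measurable
    have bad: "measure unif (bad y) \<le> \<delta>" if "y \<in> ball x0 (r / 8)" for y
      unfolding bad_def C2_def
    proof (rule contact_excess_small[OF \<Lambda> \<beta> cen sup _ a0(1) ga _ \<delta>(1)])
      show "X y \<in> ball x0 r" using X(1)[OF that] r8 by simp
    qed (use touch'[OF that] in blast)
    have close: "dist y1 y2 \<le> 3 * C2 + 10"
      if "y1 \<in> ball x0 (r / 8)" "y2 \<in> ball x0 (r / 8)" "dist (X y1) (X y2) < 1 / 4" for y1 y2
    proof (rule contact_vertices_close[OF a0(1) _ that(3)])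
      show "measure unif {z. v (X y1) + (a *\<^sub>R (y1 - X y1)) \<bullet> z + a * C2 \<le> v (X y1 + z)} < (1 / 8) ^ DIM('a)"
        using bad[OF that(1)] \<delta>(2) by (simp add: bad_def N_def)
    qed (use touch'[OF that(1)] touch'[OF that(2)] \<Lambda> C2 in auto)
    \<comment> \<open>Here 6 is 2 + 4: v is at most 2 at the contact point, and the slope term is at
      most a * r = 32 / r \<le> 4. The excess a * C2 is at most C2.\<close>
    define G where "G y = {x. v x \<le> 6 + C2} \<inter> ball (X y) (1 / 20)" for y
    have G_sets [measurable]: "G y \<in> sets borel" for y
      unfolding G_def by measurable
    have G_measure: "\<omega> * \<delta> \<le> measure lborel (G y)" if y: "y \<in> ball x0 (r / 8)" for y
    proof -
      have [measurable]: "(+) (X y) -` G y \<in> sets borel"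
        using measurable_sets_borel[of "(+) (X y)" borel "G y"] by simp
      have "ball 0 (1 / 20) \<subseteq> bad y \<union> (+) (X y) -` G y"
      proof
        fix z :: 'a assume z: "z \<in> ball 0 (1 / 20)"
        show "z \<in> bad y \<union> (+) (X y) -` G y"
        proof (cases "z \<in> bad y")
          case False
          have "(a *\<^sub>R (y - X y)) \<bullet> z \<le> norm (a *\<^sub>R (y - X y)) * norm z"
            by (rule norm_cauchy_schwarz)
          also have "\<dots> \<le> (a * r) * 1"
          proof (intro mult_mono)
            have "norm (y - X y) \<le> r"
              using y X(1)[OF y] dist_triangle3[of y "X y" x0] r8 by (simp add: dist_norm)
            then show "norm (a *\<^sub>R (y - X y)) \<le> a * r" using a0 by simp
          qed (use z a0 r8 in auto)
          also have "\<dots> \<le> 32 / 8" unfolding mult_1_right ar using r8 by (intro divide_left_mono) auto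
          finally have "v (X y + z) < 2 + 4 + a * C2"
            using False X(2)[OF y] by (simp add: bad_def)
          moreover have "a * C2 \<le> C2" using a0 C2 by simp
          ultimately show ?thesis using z by (simp add: G_def dist_norm)
        qed simp
      qed
      then have "measure unif (ball (0::'a) (1 / 20)) \<le> measure unif (bad y \<union> (+) (X y) -` G y)"
        by (intro U.finite_measure_mono) auto
      also have "\<dots> \<le> measure unif (bad y) + measure unif ((+) (X y) -` G y)"
        by (intro measure_Un_le) auto
      also have "measure unif ((+) (X y) -` G y) = measure lborel (G y) / \<omega>"
        unfolding \<omega>_def by (rule measure_unif_vimage_plus) (auto simp: G_def)
      finally have "2 * \<delta> \<le> \<delta> + measure lborel (G y) / \<omega>"
        using bad[OF y] by (simp add: measure_unif_ball \<delta>_def N_def)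
      then show ?thesis using \<omega> by (simp add: field_simps)
    qed
    \<comment> \<open>The index set consists of vertices while the balls sit at the contact points.
      Disjointness separates the sets \<open>G j\<close>; the fivefold enlargement has radius 1 / 4,
      which is the range of \<open>close\<close>.\<close>
    obtain C where C: "countable C" "C \<subseteq> ball x0 (r / 8)"
      and disj: "pairwise (\<lambda>i j. disjnt (cball (X i) (1 / 20)) (cball (X j) (1 / 20))) C"
      and cov: "\<And>i. i \<in> ball x0 (r / 8) \<Longrightarrow> \<exists>j. j \<in> C \<and>
        \<not> disjnt (cball (X i) (1 / 20)) (cball (X j) (1 / 20)) \<and>
        cball (X i) (1 / 20) \<subseteq> ball (X j) (5 * (1 / 20))"
      by (rule Vitali_covering_lemma_cballs_balls[where K="ball x0 (r / 8)" and a=X and r="\<lambda>_. 1/20" and B=1])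
         auto
    define S where "S = {x. v x \<le> 6 + C2} \<inter> ball x0 r"
    have [measurable]: "S \<in> sets borel" unfolding S_def by measurable
    have S_fin: "S \<in> fmeasurable lborel"
      by (rule bounded_borel_fmeasurable) (auto simp: S_def intro: bounded_subset[OF bounded_ball])
    have count: "card F * (\<omega> * \<delta>) \<le> measure lborel S" if F: "F \<subseteq> C" "finite F" for F
    proof -
      have G_fin: "G y \<in> fmeasurable lborel" for y
        by (rule bounded_borel_fmeasurable) (auto simp: G_def intro: bounded_subset[OF bounded_ball])
      have "card F * (\<omega> * \<delta>) = (\<Sum>y\<in>F. \<omega> * \<delta>)" by simp
      also have "\<dots> \<le> (\<Sum>y\<in>F. measure lborel (G y))"
        using F C(2) by (intro sum_mono G_measure) auto
      also have "\<dots> = measure lborel (\<Union>y\<in>F. G y)"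
      proof (rule measure_UNION'[symmetric])
        show "pairwise (\<lambda>i j. disjnt (G i) (G j)) F"
          by (rule pairwise_mono[OF disj _ F(1)]) (erule disjnt_subset1[OF disjnt_subset2]; force simp: G_def)
      qed (use F G_fin in auto)
      also have "\<dots> \<le> measure lborel S"
      proof (rule measure_mono_fmeasurable[OF _ _ S_fin])
        show "(\<Union>y\<in>F. G y) \<subseteq> S"
        proof (rule UN_least)
          fix y assume "y \<in> F"
          then have "X y \<in> ball x0 (r / 2)" using F C(2) X(1) by auto
          then have "ball (X y) (1 / 20) \<subseteq> ball x0 r"
            using r8 by (simp add: ball_subset_ball_iff dist_commute)
          then show "G y \<subseteq> S" by (auto simp: G_def S_def)
        qed
        show "(\<Union>y\<in>F. G y) \<in> sets lborel" using F by auto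
      qed
      finally show ?thesis .
    qed
    have "finite C"
    proof (rule finite_if_finite_subsets_card_bdd[where C="nat \<lfloor>measure lborel S / (\<omega> * \<delta>)\<rfloor>", THEN conjunct1])
      fix F assume "F \<subseteq> C" "finite F"
      from count[OF this] have "real (card F) \<le> measure lborel S / (\<omega> * \<delta>)"
        using \<omega> \<delta> by (simp add: field_simps)
      then show "card F \<le> nat \<lfloor>measure lborel S / (\<omega> * \<delta>)\<rfloor>"
        by (simp add: le_nat_floor)
    qed
    have "ball x0 (r / 8) \<subseteq> (\<Union>j\<in>C. ball j (3 * C2 + 11))"
    proof
      fix y assume y: "y \<in> ball x0 (r / 8)"
      from cov[OF y] obtain j where j: "j \<in> C" "cball (X y) (1 / 20) \<subseteq> ball (X j) (5 * (1 / 20))"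
        by blast
      moreover have "X y \<in> cball (X y) (1 / 20)" by simp
      ultimately have "X y \<in> ball (X j) (5 * (1 / 20))" by blast
      then have "dist j y \<le> 3 * C2 + 10"
        using j C(2) y by (intro close) auto
      then show "y \<in> (\<Union>j\<in>C. ball j (3 * C2 + 11))" using j by force
    qed
    then have "measure lborel (ball x0 (r / 8)) \<le> measure lborel (\<Union>j\<in>C. ball j (3 * C2 + 11))"
      using \<open>finite C\<close>
      by (intro measure_mono_fmeasurable bounded_borel_fmeasurable) auto
    also have "\<dots> \<le> (\<Sum>j\<in>C. measure lborel (ball j (3 * C2 + 11)))"
      using \<open>finite C\<close> by (intro measure_UNION_le) auto
    also have "\<dots> = card C * ((3 * C2 + 11) ^ N * \<omega>)"
      using C2 content_ball_conv_unit_ball[where 'a='a, of "3 * C2 + 11"] by (simp add: N_def \<omega>_def)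
    finally have "(r / 8) ^ N * \<omega> \<le> card C * ((3 * C2 + 11) ^ N * \<omega>)"
      using r8 content_ball_conv_unit_ball[where 'a='a, of "r / 8"] by (simp add: N_def \<omega>_def)
    then have "(r / 8) ^ N \<le> card C * (3 * C2 + 11) ^ N"
      using \<omega> by simp
    then have "(r / 8) ^ N / (3 * C2 + 11) ^ N \<le> card C"
      using C2 by (simp add: field_simps)
    then have "(r / 8) ^ N / (3 * C2 + 11) ^ N * (\<omega> * \<delta>) \<le> card C * (\<omega> * \<delta>)"
      using \<omega> \<delta> by (intro mult_right_mono) auto
    moreover have "\<mu> * r ^ N = (r / 8) ^ N / (3 * C2 + 11) ^ N * (\<omega> * \<delta>)"
      by (simp add: \<mu>_def power_divide power_mult_distrib)
    ultimately show ?thesis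
      using count[of C] \<open>finite C\<close> by (simp add: S_def)
  qed
  then show ?thesis
    using C2 \<mu> unfolding N_def
    by - (rule exI[of _ "6 + C2"], rule conjI, simp, rule exI[of _ \<mu>], rule conjI, assumption, blast)
qed

section \<open>Expansion of positivity\<close>

lemma gauss_shift:
  fixes x y z :: "'a::euclidean_space"
  shows "exp (- b * (norm (x + z - y))\<^sup>2) =
    exp (- b * (norm (x - y))\<^sup>2) * exp (- b * (norm z)\<^sup>2 - 2 * b * ((x - y) \<bullet> z))"
proof -
  have "(norm (x + z - y))\<^sup>2 = (norm (x - y))\<^sup>2 + (norm z)\<^sup>2 + 2 * ((x - y) \<bullet> z)"
    unfolding power2_norm_eq_inner by (simp add: algebra_simps inner_commute)
  then have "- b * (norm (x + z - y))\<^sup>2 =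
      - b * (norm (x - y))\<^sup>2 + (- b * (norm z)\<^sup>2 - 2 * b * ((x - y) \<bullet> z))"
    by (simp only: distrib_left)
  then show ?thesis by (simp only: exp_add)
qed

lemma bounded_gauss:
  "0 \<le> b \<Longrightarrow> bounded (range (\<lambda>x::'a::euclidean_space. exp (- b * (norm (x - y))\<^sup>2)))"
  by (auto simp: bounded_iff intro!: exI[of _ 1])

lemma gauss_integrable:
  fixes y :: "'a::euclidean_space"
  assumes "centred \<Lambda> \<mu>" "0 \<le> b"
  shows "integrable \<mu> (\<lambda>z. exp (- b * (norm (x + z - y))\<^sup>2))"
  by (rule bounded_translate_integrable[OF assms(1) _ bounded_gauss[OF assms(2)]]) measurable

text \<open>The tangent bound 1 + t \<le> exp t gives an affine minorant in z, so an arbitrary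
  centred kernel loses at most the relative amount b * \<Lambda>^2.\<close>

lemma gauss_centred_ge:
  fixes y :: "'a::euclidean_space"
  assumes cen: "centred \<Lambda> \<mu>" and b: "0 \<le> b"
  shows "exp (- b * (norm (x - y))\<^sup>2) * (1 - b * \<Lambda>\<^sup>2) \<le> (\<integral>z. exp (- b * (norm (x + z - y))\<^sup>2) \<partial>\<mu>)"
proof (rule centred_integral_affine_ge[OF cen gauss_integrable[OF cen b]])
  fix z :: 'a assume z: "norm z < \<Lambda>"
  define E where "E = exp (- b * (norm (x - y))\<^sup>2)"
  have "b * (norm z)\<^sup>2 \<le> b * \<Lambda>\<^sup>2"
    using z b by (intro mult_left_mono power_mono) auto
  then have "1 - b * \<Lambda>\<^sup>2 - 2 * b * ((x - y) \<bullet> z) \<le> 1 + (- b * (norm z)\<^sup>2 - 2 * b * ((x - y) \<bullet> z))"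
    by simp
  also have "\<dots> \<le> exp (- b * (norm z)\<^sup>2 - 2 * b * ((x - y) \<bullet> z))"
    by (rule exp_ge_add_one_self)
  finally have "E * (1 - b * \<Lambda>\<^sup>2 - 2 * b * ((x - y) \<bullet> z)) \<le> exp (- b * (norm (x + z - y))\<^sup>2)"
    unfolding gauss_shift[of b x z y] E_def by (intro mult_left_mono) auto
  then show "exp (- b * (norm (x - y))\<^sup>2) * (1 - b * \<Lambda>\<^sup>2) + ((- 2 * b * E) *\<^sub>R (x - y)) \<bullet> z
    \<le> exp (- b * (norm (x + z - y))\<^sup>2)"
    by (simp add: E_def algebra_simps)
qed

text \<open>The uniform kernel charges a small ball B on the side of x facing y. There the linear
  exponent is at least b * norm (x - y) / 2, and the quadratic Taylor bound for exp improves on the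
  tangent bound by k. Elsewhere the tangent bound is kept, its linear part having mean zero; 1 - b
  accounts for the factor exp (- b * (norm z)^2).\<close>

lemma gauss_unif_ge:
  fixes y :: "'a::euclidean_space"
  assumes b: "0 \<le> b" "b \<le> 1" and "x \<noteq> y"
  shows "exp (- b * (norm (x - y))\<^sup>2) * ((1 - b) * (1 + b\<^sup>2 * (norm (x - y))\<^sup>2 / 8 * (1 / 4) ^ DIM('a)))
    \<le> (\<integral>z. exp (- b * (norm (x + z - y))\<^sup>2) \<partial>unif)"
proof -
  interpret U: prob_space "unif :: 'a measure" by (rule prob_space_unif)
  have cen: "centred 1 (unif :: 'a measure)" by (rule centred_unif) simp
  define w where "w = x - y"
  define e where "e = w /\<^sub>R norm w"
  define B where "B = ball (- e /\<^sub>R 2) (1 / 4)"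
  define k where "k = b\<^sup>2 * (norm w)\<^sup>2 / 8"
  define E where "E = exp (- b * (norm w)\<^sup>2)"
  have w: "norm w > 0" using assms by (simp add: w_def)
  then have e: "norm e = 1" "w \<bullet> e = norm w"
    by (simp_all add: e_def dot_square_norm power2_eq_square)
  have intI: "integrable unif (\<lambda>z. k * indicator B z :: real)"
    by (rule centred_integrable[OF cen, where B="\<bar>k\<bar>"]) (auto simp: B_def indicator_def)
  have int0: "(\<integral>z. w \<bullet> z \<partial>(unif :: 'a measure)) = 0"
    using cen by (simp add: centred_def)
  have "measure unif B = (1 / 4) ^ DIM('a)"
    unfolding B_def using e by (intro measure_unif_ball) auto
  then have "E * (1 - b) * (1 + k * (1 / 4) ^ DIM('a)) =
    (\<integral>z. E * (1 - b) * (1 - 2 * b * (w \<bullet> z) + k * indicator B z) \<partial>unif)"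
    using intI centred_inner_integrable[OF cen, of w] int0
    by (simp add: U.prob_space[simplified] B_def)
  also have "\<dots> \<le> (\<integral>z. exp (- b * (norm (x + z - y))\<^sup>2) \<partial>unif)"
  proof (rule centred_integral_mono[OF cen _ gauss_integrable[OF cen b(1)]])
    fix z :: 'a assume z: "norm z < 1"
    have "1 - 2 * b * (w \<bullet> z) + k * indicator B z \<le> exp (- (2 * b * (w \<bullet> z)))"
    proof (cases "z \<in> B")
      case True
      have "\<bar>w \<bullet> (z + e /\<^sub>R 2)\<bar> \<le> norm w * norm (z + e /\<^sub>R 2)"
        by (rule Cauchy_Schwarz_ineq2)
      also have "\<dots> \<le> norm w * (1 / 4)"
        using True by (intro mult_left_mono) (auto simp: B_def dist_norm norm_minus_commute)
      finally have "\<bar>w \<bullet> (z + e /\<^sub>R 2)\<bar> \<le> norm w * (1 / 4)" .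
      moreover have "w \<bullet> (z + e /\<^sub>R 2) = w \<bullet> z + norm w / 2"
        using e by (simp add: inner_add_right)
      ultimately have "norm w / 4 \<le> - (w \<bullet> z)" by linarith
      then have "2 * b * (norm w / 4) \<le> 2 * b * - (w \<bullet> z)"
        using b by (intro mult_left_mono) auto
      then have t: "b * norm w / 2 \<le> - (2 * b * (w \<bullet> z))" by simp
      then have "(b * norm w / 2)\<^sup>2 \<le> (- (2 * b * (w \<bullet> z)))\<^sup>2"
        using b by (intro power_mono) auto
      then have "k \<le> (- (2 * b * (w \<bullet> z)))\<^sup>2 / 2"
        by (simp add: k_def power_mult_distrib power_divide)
      moreover have "0 \<le> - (2 * b * (w \<bullet> z))"
        using t b by (intro order_trans[OF _ t]) auto
      ultimately show ?thesis
        using exp_lower_Taylor_quadratic[of "- (2 * b * (w \<bullet> z))"] True by simp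
    next
      case False
      then show ?thesis using exp_ge_add_one_self[of "- (2 * b * (w \<bullet> z))"] by simp
    qed
    then have "(1 - b) * (1 - 2 * b * (w \<bullet> z) + k * indicator B z) \<le> (1 - b) * exp (- (2 * b * (w \<bullet> z)))"
      using b by (intro mult_left_mono) auto
    also have "\<dots> \<le> exp (- b * (norm z)\<^sup>2) * exp (- (2 * b * (w \<bullet> z)))"
    proof (intro mult_right_mono)
      have "b * (norm z)\<^sup>2 \<le> b" using b z by (simp add: mult_left_le power_le_one_iff)
      then show "1 - b \<le> exp (- b * (norm z)\<^sup>2)"
        using exp_ge_add_one_self[of "- b * (norm z)\<^sup>2"] by simp
    qed auto
    finally have "E * ((1 - b) * (1 - 2 * b * (w \<bullet> z) + k * indicator B z)) \<le>
        E * (exp (- b * (norm z)\<^sup>2) * exp (- (2 * b * (w \<bullet> z))))"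
      by (intro mult_left_mono) (auto simp: E_def)
    then show "E * (1 - b) * (1 - 2 * b * (w \<bullet> z) + k * indicator B z) \<le> exp (- b * (norm (x + z - y))\<^sup>2)"
      unfolding gauss_shift[of b x z y] E_def w_def
      by (simp add: exp_add[symmetric] mult.assoc)
  qed (use intI centred_inner_integrable[OF cen, of w] in auto)
  finally show ?thesis by (simp add: E_def k_def w_def mult.assoc)
qed

text \<open>All losses are of order b, whereas off the ball of radius \<rho> the gain of the uniform
  part is a multiple of b^2 * \<rho>^2 = b * A. With this A, half of the weighted gain, which
  survives the factor 1 - b, equals b * (\<Lambda>^2 + 2): this pays b * \<Lambda>^2 for the centred
  part, b for the uniform part, and leaves b as surplus.\<close>

lemma barrier_gain:
  fixes \<Lambda> \<beta> :: real and y :: "'a::euclidean_space"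
  assumes \<Lambda>: "1 \<le> \<Lambda>" and \<beta>: "0 < \<beta>" "\<beta> \<le> 1" and cen: "centred \<Lambda> \<mu>"
    and A: "A = 2 * (\<Lambda>\<^sup>2 + 2) / (\<beta> * ((1 / 4) ^ DIM('a) / 8))"
    and b: "b = A / \<rho>\<^sup>2" "b \<le> 1 / 2" and \<rho>: "0 < \<rho>" "\<rho> \<le> norm (x - y)"
  shows "exp (- b * (norm (x - y))\<^sup>2) * (1 + b) \<le>
    (1 - \<beta>) * (\<integral>z. exp (- b * (norm (x + z - y))\<^sup>2) \<partial>\<mu>) + \<beta> * (\<integral>z. exp (- b * (norm (x + z - y))\<^sup>2) \<partial>unif)"
proof -
  define E where "E = exp (- b * (norm (x - y))\<^sup>2)"
  define k :: real where "k = (1 / 4) ^ DIM('a) / 8"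
  have k: "0 < k" by (simp add: k_def)
  have A0: "0 < A" using \<Lambda> \<beta> k unfolding A k_def[symmetric] by (auto intro!: divide_pos_pos add_nonneg_pos)
  have b0: "0 < b" using A0 b \<rho> by simp
  have \<beta>kA: "\<beta> * k * A = 2 * (\<Lambda>\<^sup>2 + 2)" using \<beta> k by (simp add: A k_def)
  have "b\<^sup>2 * \<rho>\<^sup>2 \<le> b\<^sup>2 * (norm (x - y))\<^sup>2"
    using \<rho> by (intro mult_left_mono power_mono) auto
  moreover have "b\<^sup>2 * \<rho>\<^sup>2 = b * A" using b \<rho> by (simp add: power2_eq_square)
  ultimately have bA: "b * A \<le> b\<^sup>2 * (norm (x - y))\<^sup>2" by simp
  have "1 + b \<le> (1 - \<beta>) * (1 - b * \<Lambda>\<^sup>2) + \<beta> * ((1 - b) * (1 + k * (b * A)))"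
  proof -
    have "b * (k * (b * A)) \<le> 1 / 2 * (k * (b * A))"
      using b b0 k A0 by (intro mult_right_mono) auto
    then have "1 - b + k * (b * A) / 2 \<le> (1 - b) * (1 + k * (b * A))"
      by (simp add: algebra_simps)
    then have "\<beta> * (1 - b + k * (b * A) / 2) \<le> \<beta> * ((1 - b) * (1 + k * (b * A)))"
      using \<beta> by (intro mult_left_mono) auto
    moreover have "\<beta> * (k * (b * A) / 2) = b * (\<Lambda>\<^sup>2 + 2)"
    proof -
      have "\<beta> * (k * (b * A) / 2) = b * (\<beta> * k * A) / 2" by simp
      then show ?thesis unfolding \<beta>kA by (simp add: algebra_simps)
    qed
    moreover have "(1 - \<beta>) * (b * \<Lambda>\<^sup>2) \<le> 1 * (b * \<Lambda>\<^sup>2)" "\<beta> * b \<le> 1 * b"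
      using \<beta> b0 by (intro mult_right_mono; simp)+
    moreover have "\<beta> * (1 - b + k * (b * A) / 2) = \<beta> - \<beta> * b + \<beta> * (k * (b * A) / 2)"
      "(1 - \<beta>) * (1 - b * \<Lambda>\<^sup>2) = 1 - \<beta> - (1 - \<beta>) * (b * \<Lambda>\<^sup>2)" "b * (\<Lambda>\<^sup>2 + 2) = b * \<Lambda>\<^sup>2 + 2 * b"
      by (simp_all add: algebra_simps)
    ultimately show ?thesis by linarith
  qed
  also have "\<dots> \<le> (1 - \<beta>) * (1 - b * \<Lambda>\<^sup>2) + \<beta> * ((1 - b) * (1 + k * (b\<^sup>2 * (norm (x - y))\<^sup>2)))"
    using bA \<beta> b(2) b0 k by (intro add_left_mono mult_left_mono) auto
  finally have "E * (1 + b) \<le> E * ((1 - \<beta>) * (1 - b * \<Lambda>\<^sup>2) + \<beta> * ((1 - b) * (1 + k * (b\<^sup>2 * (norm (x - y))\<^sup>2))))"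
    by (intro mult_left_mono) (auto simp: E_def)
  also have "\<dots> = (1 - \<beta>) * (E * (1 - b * \<Lambda>\<^sup>2)) +
      \<beta> * (E * ((1 - b) * (1 + b\<^sup>2 * (norm (x - y))\<^sup>2 / 8 * (1 / 4) ^ DIM('a))))"
    by (simp add: k_def algebra_simps)
  also have "\<dots> \<le> (1 - \<beta>) * (\<integral>z. exp (- b * (norm (x + z - y))\<^sup>2) \<partial>\<mu>) +
      \<beta> * (\<integral>z. exp (- b * (norm (x + z - y))\<^sup>2) \<partial>unif)"
    unfolding E_def using \<beta> b0 b(2) \<rho>
    by (intro add_mono mult_left_mono gauss_centred_ge[OF cen] gauss_unif_ge) auto
  finally show ?thesis by (simp add: E_def)
qed

text \<open>The difference of v and the Gaussian cannot have an infimum below -m. On the core ball v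
  is at least 1, hence above the Gaussian; beyond radius 2 * D * \<rho> the Gaussian is at most m
  and v is nonnegative; in between, \<open>barrier_gain\<close> improves a near-minimal value by
  more than the error allows. The infimum is taken over a ball with margin \<Lambda>, which contains
  every jump from the smaller ball.\<close>

lemma expansion_of_positivity:
  fixes \<Lambda> \<beta> D :: real
  assumes \<Lambda>: "1 \<le> \<Lambda>" and \<beta>: "0 < \<beta>" "\<beta> \<le> 1" and D: "1 \<le> D"
  shows "\<exists>c>0. \<exists>\<kappa>>0. \<exists>\<rho>\<^sub>0>0. \<forall>(\<nu> :: 'a::euclidean_space \<Rightarrow> 'a measure) g v y \<rho>.
    (\<forall>x. centred \<Lambda> (\<nu> x)) \<longrightarrow> \<rho>\<^sub>0 \<le> \<rho> \<longrightarrow> g \<le> \<kappa> / \<rho>\<^sup>2 \<longrightarrow>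
    supersolution (1 - \<beta>) \<beta> \<nu> g (ball y (2 * D * \<rho>)) v \<longrightarrow>
    (\<forall>x\<in>ball y (2 * D * \<rho> + \<Lambda>). 0 \<le> v x) \<longrightarrow> (\<forall>x\<in>ball y \<rho>. 1 \<le> v x) \<longrightarrow>
    (\<forall>x\<in>ball y (D * \<rho>). c \<le> v x)"
proof -
  define A where "A = 2 * (\<Lambda>\<^sup>2 + 2) / (\<beta> * ((1 / 4) ^ DIM('a) / 8))"
  have A: "0 < A" using \<Lambda> \<beta> unfolding A_def by (auto intro!: divide_pos_pos add_nonneg_pos)
  \<comment> \<open>With b = A / \<rho>^2 this is the Gaussian at distance 2 * D * \<rho>, and c is
    the amount by which it is larger at distance D * \<rho>.\<close>
  define m where "m = exp (- 4 * A * D\<^sup>2)"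
  define c where "c = exp (- A * D\<^sup>2) - m"
  have c: "0 < c" using A D by (simp add: c_def m_def)
  have m: "0 < m" by (simp add: m_def)
  have "c \<le> v x0"
    if cen: "\<And>x. centred \<Lambda> (\<nu> x)" and \<rho>: "2 * A + 1 \<le> \<rho>" and g: "g \<le> (A * m / 2) / \<rho>\<^sup>2"
      and sup: "supersolution (1 - \<beta>) \<beta> \<nu> g (ball y (2 * D * \<rho>)) v"
      and nn: "\<And>x. x \<in> ball y (2 * D * \<rho> + \<Lambda>) \<Longrightarrow> 0 \<le> v x"
      and one: "\<And>x. x \<in> ball y \<rho> \<Longrightarrow> 1 \<le> v x" and x0: "x0 \<in> ball y (D * \<rho>)"
    for \<nu> :: "'a \<Rightarrow> 'a measure" and g v y \<rho> x0
  proof -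
    define b where "b = A / \<rho>\<^sup>2"
    have \<rho>0: "0 < \<rho>" "1 \<le> \<rho>" using A \<rho> by auto
    have "\<rho> \<le> \<rho>\<^sup>2" using \<rho>0 by (simp add: power2_eq_square)
    then have b: "0 < b" "b \<le> 1 / 2" using A \<rho> \<rho>0 by (auto simp: b_def pos_divide_le_eq)
    have b\<rho>: "b * \<rho>\<^sup>2 = A" using \<rho>0 by (simp add: b_def)
    define \<phi> where "\<phi> x = exp (- b * (norm (x - y))\<^sup>2)" for x
    have \<phi>_ge: "exp (- A * d\<^sup>2) \<le> \<phi> x" if "norm (x - y) \<le> d * \<rho>" "0 \<le> d" for x d
    proof -
      have "b * (norm (x - y))\<^sup>2 \<le> b * (d * \<rho>)\<^sup>2"
        using that b by (intro mult_left_mono power_mono) auto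
      also have "\<dots> = d\<^sup>2 * (b * \<rho>\<^sup>2)" by (simp add: power_mult_distrib)
      finally show ?thesis by (simp add: \<phi>_def b\<rho> mult.commute)
    qed
    have \<phi>_le: "\<phi> x \<le> m" if "2 * D * \<rho> \<le> norm (x - y)" for x
    proof -
      have "b * (2 * D * \<rho>)\<^sup>2 \<le> b * (norm (x - y))\<^sup>2"
        using that b D \<rho>0 by (intro mult_left_mono power_mono) auto
      moreover have "b * (2 * D * \<rho>)\<^sup>2 = 4 * D\<^sup>2 * (b * \<rho>\<^sup>2)" by (simp add: power_mult_distrib)
      ultimately show ?thesis by (simp add: \<phi>_def b\<rho> m_def mult_ac)
    qed
    define S where "S = ball y (2 * D * \<rho> + \<Lambda>)"
    define I where "I = (INF x\<in>S. v x - \<phi> x)"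
    have "\<phi> x \<le> 1" for x using b by (simp add: \<phi>_def)
    then have bdd: "bdd_below ((\<lambda>x. v x - \<phi> x) ` S)"
      using nn by (intro bdd_belowI[where m="-1"]) (smt (verit) S_def imageE)
    have I_le: "I \<le> v x - \<phi> x" if "x \<in> S" for x
      unfolding I_def using bdd that by (rule cINF_lower)
    have "- m \<le> I"
    proof (rule ccontr)
      assume "\<not> - m \<le> I"
      then have I: "I < - m" by simp
      have "y \<in> S" using D \<rho>0 \<Lambda> by (simp add: S_def add_nonneg_pos)
      \<comment> \<open>The first bound places the near-minimiser in the annulus. The second is half
        of the guaranteed gain b * m; the other half is reserved for g.\<close>
      have "Inf ((\<lambda>x. v x - \<phi> x) ` S) < min (- m) (I + b * m / 2)"
        using I b m by (simp add: I_def)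
      then obtain x where x: "x \<in> S" "v x - \<phi> x < - m" "v x - \<phi> x < I + b * m / 2"
        using \<open>y \<in> S\<close> by (subst (asm) cInf_less_iff) (use bdd in auto)
      have "norm (x - y) < 2 * D * \<rho>"
        using \<phi>_le[of x] nn[of x] x by (force simp: S_def)
      moreover have "\<rho> \<le> norm (x - y)"
      proof (rule ccontr)
        assume "\<not> \<rho> \<le> norm (x - y)"
        then have "1 \<le> v x" using one[of x] by (simp add: dist_norm norm_minus_commute)
        then show False using \<open>\<phi> x \<le> 1\<close> x(2) m by simp
      qed
      ultimately have x': "x \<in> ball y (2 * D * \<rho>)" "m \<le> \<phi> x"
        using \<phi>_ge[of x "2 * D"] D by (auto simp: m_def dist_norm norm_minus_commute power_mult_distrib mult.assoc mult.left_commute)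
      have ge: "(\<integral>z. \<phi> (x + z) \<partial>\<mu>) + I \<le> (\<integral>z. v (x + z) \<partial>\<mu>)" if \<mu>: "centred \<Lambda> \<mu>" for \<mu>
      proof -
        interpret prob_space \<mu> using \<mu> by (simp add: centred_def)
        note int = gauss_integrable[OF \<mu>, of b x y, folded \<phi>_def] supersolution_integrable[OF sup \<mu>]
        have "(\<integral>z. \<phi> (x + z) + I \<partial>\<mu>) \<le> (\<integral>z. v (x + z) \<partial>\<mu>)"
        proof (rule centred_integral_mono[OF \<mu>])
          fix z :: 'a assume "norm z < \<Lambda>"
          then have "x + z \<in> S"
            using x'(1) norm_triangle_ineq[of "x - y" z]
            by (simp add: S_def dist_norm norm_minus_commute[of y] algebra_simps)
          then show "\<phi> (x + z) + I \<le> v (x + z)" using I_le by fastforce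
        qed (use int b in auto)
        then show ?thesis using int b by (simp add: prob_space)
      qed
      have "\<phi> x * (1 + b) + I \<le> (1 - \<beta>) * ((\<integral>z. \<phi> (x + z) \<partial>\<nu> x) + I) + \<beta> * ((\<integral>z. \<phi> (x + z) \<partial>unif) + I)"
        using barrier_gain[OF \<Lambda> \<beta> cen A_def b_def b(2) \<rho>0(1) \<open>\<rho> \<le> norm (x - y)\<close>]
        by (simp add: \<phi>_def algebra_simps)
      also have "\<dots> \<le> (1 - \<beta>) * (\<integral>z. v (x + z) \<partial>\<nu> x) + \<beta> * (\<integral>z. v (x + z) \<partial>unif)"
        using \<beta> by (intro add_mono mult_left_mono ge cen centred_unif \<Lambda>) auto
      also have "\<dots> \<le> v x + g"
        using sup x'(1) unfolding supersolution_def by (metis diff_le_eq)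
      finally have "b * \<phi> x + I - g \<le> v x - \<phi> x" by (simp add: algebra_simps)
      moreover have "b * m \<le> b * \<phi> x" using x'(2) b by simp
      moreover have "g \<le> b * m / 2" using g by (simp add: b_def)
      ultimately show False using x(3) by simp
    qed
    have "D * \<rho> \<le> 2 * D * \<rho> + \<Lambda>" using D \<rho>0 \<Lambda> by simp
    then have "x0 \<in> S" using x0 by (simp add: S_def)
    from I_le[OF this] have "\<phi> x0 - m \<le> v x0" using \<open>- m \<le> I\<close> by simp
    moreover have "exp (- A * D\<^sup>2) \<le> \<phi> x0"
      using x0 D by (intro \<phi>_ge) (auto simp: dist_norm norm_minus_commute)
    ultimately show ?thesis by (simp add: c_def)
  qed
  then show ?thesis
    using c A m
    by - (rule exI[of _ c], rule conjI, simp, rule exI[of _ "A * m / 2"], rule conjI, simp,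
        rule exI[of _ "2 * A + 1"], rule conjI, simp, blast)
qed

section \<open>Dense sets at all scales\<close>

text \<open>A single average of nonnegative values: the \<open>\<nu> x\<close> part is discarded and
  the uniform part retains the share of S in the unit ball. It serves at scales comparable to the
  kernel.\<close>

lemma supersolution_measure_bound:
  fixes v :: "'a::euclidean_space \<Rightarrow> real"
  assumes \<Lambda>: "1 \<le> \<Lambda>" and \<beta>: "0 < \<beta>" "\<beta> \<le> 1" and cen: "centred \<Lambda> (\<nu> x)"
    and sup: "supersolution (1 - \<beta>) \<beta> \<nu> g D v" and x: "x \<in> D"
    and nn: "\<And>x'. x' \<in> ball x \<Lambda> \<Longrightarrow> 0 \<le> v x'"
    and S: "S \<in> sets borel" "S \<subseteq> ball x 1" "\<And>x'. x' \<in> S \<Longrightarrow> t \<le> v x'"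
  shows "\<beta> * t * (measure lborel S / measure lborel (ball (0::'a) 1)) - g \<le> v x"
proof -
  have cenU: "centred 1 (unif :: 'a measure)" by (rule centred_unif) simp
  have [measurable]: "(+) x -` S \<in> sets borel"
    using measurable_sets_borel[of "(+) x" borel S] S(1) by simp
  have ball: "x + z \<in> ball x \<Lambda>" if "norm z < \<Lambda>" for z
    using that by (simp add: dist_norm)
  have "0 \<le> (\<integral>z. v (x + z) \<partial>\<nu> x)"
    by (rule centred_integral_affine_ge[OF cen supersolution_integrable[OF sup cen], where q=0])
      (use nn ball in simp)
  then have 1: "0 \<le> (1 - \<beta>) * (\<integral>z. v (x + z) \<partial>\<nu> x)" using \<beta> by simp
  have "t * measure unif ((+) x -` S) = (\<integral>z. t * indicator ((+) x -` S) z \<partial>unif)"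
    by simp
  also have "\<dots> \<le> (\<integral>z. v (x + z) \<partial>unif)"
  proof (rule centred_integral_mono[OF cenU _ supersolution_integrable[OF sup cenU]])
    show "integrable unif (\<lambda>z. t * indicator ((+) x -` S) z :: real)"
    proof (rule centred_integrable[OF cenU, where B="\<bar>t\<bar>"])
      show "(\<lambda>z. t * indicator ((+) x -` S) z :: real) \<in> borel_measurable borel"
        by measurable
    qed (simp add: indicator_def)
    fix z :: 'a assume "norm z < 1"
    then show "t * indicator ((+) x -` S) z \<le> v (x + z)"
      using S(3) nn[OF ball, of z] \<Lambda> by (auto simp: indicator_def)
  qed
  finally have "\<beta> * (t * (measure lborel S / measure lborel (ball (0::'a) 1))) \<le> \<beta> * (\<integral>z. v (x + z) \<partial>unif)"
    using \<beta> by (intro mult_left_mono) (auto simp: measure_unif_vimage_plus[OF S(1,2)])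
  then show ?thesis
    using 1 sup x by (fastforce simp: supersolution_def)
qed

text \<open>Each average enlarges the ball by 1 / 4. A ball of radius 1 / 4 has share (1 / 4) ^
  DIM('a) in the unit ball; c keeps half of the resulting factor, and the other half absorbs g at
  every one of the J steps.\<close>

lemma unit_scale_chain:
  fixes v :: "'a::euclidean_space \<Rightarrow> real"
  assumes \<Lambda>: "1 \<le> \<Lambda>" and \<beta>: "0 < \<beta>" "\<beta> \<le> 1" and cen: "\<And>x. centred \<Lambda> (\<nu> x)"
    and c: "c = \<beta> * (1 / 4) ^ DIM('a) / 2" and g: "g \<le> c ^ J"
    and sup: "supersolution (1 - \<beta>) \<beta> \<nu> g (ball y (real (J + 1) / 4)) v"
    and nn: "\<And>x. x \<in> ball y (real (J + 1) / 4 + \<Lambda>) \<Longrightarrow> 0 \<le> v x"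
    and one: "\<And>x. x \<in> ball y (1 / 4) \<Longrightarrow> 1 \<le> v x"
  shows "x \<in> ball y (real (J + 1) / 4) \<Longrightarrow> c ^ J \<le> v x"
proof -
  have c01: "0 < c" "c \<le> 1"
    using \<beta> mult_mono[of \<beta> 1 "(1 / 4 :: real) ^ DIM('a)" 1] by (auto simp: c power_le_one)
  have "c ^ j \<le> v x" if "j \<le> J" "x \<in> ball y (real (j + 1) / 4)" for j x
    using that
  proof (induction j arbitrary: x)
    case 0
    then show ?case using one by simp
  next
    case (Suc j)
    \<comment> \<open>The ratio contracts radius (j + 2) / 4 to j / 4, so the ball of radius 1 / 4
      around x' stays where the bound is already known, while x' remains within 1 / 2 of x.\<close>
    define x' where "x' = y + (real j / real (j + 2)) *\<^sub>R (x - y)"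
    have xy: "norm (x - y) < real (j + 2) / 4"
      using Suc.prems(2) by (simp add: dist_norm norm_minus_commute)
    have "norm (x' - y) = real j / real (j + 2) * norm (x - y)"
      by (simp add: x'_def)
    also have "\<dots> \<le> real j / real (j + 2) * (real (j + 2) / 4)"
      using xy by (intro mult_left_mono) auto
    finally have x'y: "norm (x' - y) \<le> real j / 4" by simp
    have "x - x' = (1 - real j / real (j + 2)) *\<^sub>R (x - y)"
      by (simp add: x'_def algebra_simps)
    also have "1 - real j / real (j + 2) = 2 / real (j + 2)"
      by (simp add: field_simps)
    finally have "norm (x - x') = 2 / real (j + 2) * norm (x - y)"
      by simp
    also have "\<dots> \<le> 2 / real (j + 2) * (real (j + 2) / 4)"
      using xy by (intro mult_left_mono) auto
    also have "\<dots> = 1 / 2" by (simp add: field_simps)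
    finally have xx': "norm (x - x') \<le> 1 / 2" .
    have sub: "ball x' (1 / 4) \<subseteq> ball y (real (j + 1) / 4)" "ball x' (1 / 4) \<subseteq> ball x 1"
      using x'y xx' by (simp_all add: ball_subset_ball_iff dist_norm norm_minus_commute)
    have jJ: "real (Suc j + 1) / 4 \<le> real (J + 1) / 4" using Suc.prems(1) by simp
    have "\<beta> * c ^ j * (measure lborel (ball x' (1 / 4)) / measure lborel (ball (0::'a) 1)) - g \<le> v x"
    proof (rule supersolution_measure_bound[OF \<Lambda> \<beta> cen sup _ _ _ sub(2)])
      show "x \<in> ball y (real (J + 1) / 4)" using Suc.prems(2) jJ by simp
      show "c ^ j \<le> v z" if "z \<in> ball x' (1 / 4)" for z
        using that sub(1) Suc.IH Suc.prems(1) by auto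
      show "0 \<le> v z" if "z \<in> ball x \<Lambda>" for z
      proof (rule nn)
        have "dist y z < real (J + 1) / 4 + \<Lambda>"
          using that Suc.prems(2) jJ dist_triangle[of y z x] unfolding mem_ball by linarith
        then show "z \<in> ball y (real (J + 1) / 4 + \<Lambda>)" by simp
      qed
    qed simp
    moreover have "measure lborel (ball x' (1 / 4)) / measure lborel (ball (0::'a) 1) = (1 / 4) ^ DIM('a)"
      using content_ball_1_pos[where 'a='a] content_ball_conv_unit_ball[of "1/4" x'] by simp
    ultimately have "2 * c ^ Suc j - g \<le> v x" by (simp add: c mult_ac)
    moreover have "g \<le> c ^ Suc j"
      using g power_decreasing[of "Suc j" J c] Suc.prems(1) c01 by simp
    ultimately show ?case by simp
  qed
  then show "x \<in> ball y (real (J + 1) / 4) \<Longrightarrow> c ^ J \<le> v x" by blast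
qed

text \<open>For s \<ge> s0, \<open>contact_density\<close> excludes low values near y and the
  barrier spreads the bound; this uses g \<le> \<kappa> / s^2. For s between h and s0 the
  paraboloids have too little room, but boundedly many unit-scale averages reach the whole ball;
  this uses g \<le> \<kappa>. Q enters only through its volume and its inscribed ball.\<close>

lemma dense_expansion:
  fixes \<Lambda> \<beta> D h :: real
  assumes \<Lambda>: "1 \<le> \<Lambda>" and \<beta>: "0 < \<beta>" "\<beta> \<le> 1" and D: "1 \<le> D" and h: "0 < h"
  shows "\<exists>B>0. \<exists>\<mu>>0. \<exists>c>0. \<exists>\<kappa>>0. \<mu> < 1 \<and> (\<forall>(\<nu> :: 'a::euclidean_space \<Rightarrow> 'a measure) g v y s Q.
    (\<forall>x. centred \<Lambda> (\<nu> x)) \<longrightarrow> h \<le> s \<longrightarrow> g \<le> \<kappa> / s\<^sup>2 \<longrightarrow> g \<le> \<kappa> \<longrightarrow>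
    supersolution (1 - \<beta>) \<beta> \<nu> g (ball y (2 * D * s + B)) v \<longrightarrow>
    (\<forall>x\<in>ball y (2 * D * s + B). 0 \<le> v x) \<longrightarrow>
    Q \<in> fmeasurable lborel \<longrightarrow> ball y (s / 2) \<subseteq> Q \<longrightarrow> measure lborel Q = s ^ DIM('a) \<longrightarrow>
    (1 - \<mu>) * s ^ DIM('a) \<le> measure lborel ({x. 1 \<le> v x} \<inter> Q) \<longrightarrow>
    (\<forall>x\<in>ball y (D * s). c \<le> v x))"
proof -
  define N where "N = DIM('a)"
  define \<omega> where "\<omega> = measure lborel (ball (0::'a) 1)"
  have \<omega>: "0 < \<omega>" by (simp add: \<omega>_def)
  obtain K \<mu>1 where K: "1 \<le> K" and \<mu>1: "0 < \<mu>1"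
    and density: "\<And>(\<nu> :: 'a \<Rightarrow> 'a measure) g v x0 r. \<lbrakk>\<forall>x. centred \<Lambda> (\<nu> x); 8 * \<Lambda> \<le> r; g \<le> 1 / r\<^sup>2;
      supersolution (1 - \<beta>) \<beta> \<nu> g (ball x0 r) v; \<forall>x\<in>ball x0 (2 * r). 0 \<le> v x; v x0 \<le> 1\<rbrakk> \<Longrightarrow>
      \<mu>1 * r ^ N \<le> measure lborel ({x. v x \<le> K} \<inter> ball x0 r)"
    using contact_density[OF \<Lambda> \<beta>, where 'a='a] unfolding N_def by metis
  have "1 \<le> 4 * D" using D by simp
  from expansion_of_positivity[OF \<Lambda> \<beta> this, where 'a='a]
  obtain c1 \<kappa>1 \<rho>0 where c1: "0 < c1" and \<kappa>1: "0 < \<kappa>1" and \<rho>0: "0 < \<rho>0"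
    and spread: "\<And>(\<nu> :: 'a \<Rightarrow> 'a measure) g v y \<rho>. \<lbrakk>\<forall>x. centred \<Lambda> (\<nu> x); \<rho>0 \<le> \<rho>; g \<le> \<kappa>1 / \<rho>\<^sup>2;
      supersolution (1 - \<beta>) \<beta> \<nu> g (ball y (2 * (4 * D) * \<rho>)) v;
      \<forall>x\<in>ball y (2 * (4 * D) * \<rho> + \<Lambda>). 0 \<le> v x; \<forall>x\<in>ball y \<rho>. 1 \<le> v x\<rbrakk> \<Longrightarrow>
      \<forall>x\<in>ball y (4 * D * \<rho>). c1 \<le> v x"
    by metis
  define s0 where "s0 = max (32 * \<Lambda>) (4 * \<rho>0)"
  have s0: "0 < s0" "32 * \<Lambda> \<le> s0" "4 * \<rho>0 \<le> s0" using \<Lambda> by (auto simp: s0_def)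
  define r where "r = min h (1 / 2) / 2"
  have r: "0 < r" "r \<le> 1 / 4" "r \<le> h / 2" using h by (auto simp: r_def)
  define J where "J = nat \<lceil>4 * D * s0\<rceil>"
  have J: "D * s0 \<le> real (J + 1) / 4"
  proof -
    have "4 * D * s0 \<le> real J" unfolding J_def by linarith
    then show ?thesis by simp
  qed
  define c2 where "c2 = \<beta> * r ^ N / 4"
  define c3 where "c3 = \<beta> * (1 / 4) ^ N / 2"
  have c23: "0 < c2" "0 < c3" using \<beta> r by (auto simp: c2_def c3_def)
  \<comment> \<open>The second term makes a fraction \<mu> of exceptional points incompatible with
    \<open>contact_density\<close> at radius s / 4. The third keeps v \<ge> 1 on at least half of
    \<open>ball y r\<close> as long as s < s0.\<close>
  define \<mu> where "\<mu> = min (1 / 2) (min (\<mu>1 * (1 / 4) ^ N / 2) (\<omega> * (r / s0) ^ N / 2))"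
  have \<mu>: "0 < \<mu>" "\<mu> < 1" "\<mu> < \<mu>1 * (1 / 4) ^ N" "\<mu> \<le> \<omega> * (r / s0) ^ N / 2"
    using \<mu>1 \<omega> r s0 by (auto simp: \<mu>_def min_less_iff_disj)
  define c where "c = min (c1 / (2 * K)) (c2 * c3 ^ J)"
  define \<kappa> where "\<kappa> = min (min (8 / K) (8 * \<kappa>1 / K)) (min c2 (c2 * c3 ^ J))"
  define B where "B = real (J + 1) / 4 + \<Lambda>"
  have "c \<le> v x"
    if cen: "\<forall>x. centred \<Lambda> (\<nu> x)" and hs: "h \<le> s" and g: "g \<le> \<kappa> / s\<^sup>2" "g \<le> \<kappa>"
      and sup: "supersolution (1 - \<beta>) \<beta> \<nu> g (ball y (2 * D * s + B)) v"
      and nn: "\<forall>x\<in>ball y (2 * D * s + B). 0 \<le> v x"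
      and Q: "Q \<in> fmeasurable lborel" "ball y (s / 2) \<subseteq> Q" "measure lborel Q = s ^ N"
      and dense: "(1 - \<mu>) * s ^ N \<le> measure lborel ({x. 1 \<le> v x} \<inter> Q)"
      and x: "x \<in> ball y (D * s)"
    for \<nu> :: "'a \<Rightarrow> 'a measure" and g v y s Q x
  proof -
    have [measurable]: "v \<in> borel_measurable borel" using sup by (simp add: supersolution_def)
    have s: "0 < s" using h hs by simp
    have B\<Lambda>: "\<Lambda> \<le> B" by (simp add: B_def)
    have sDs: "s \<le> D * s" using D s by simp
    have Q_borel [measurable]: "Q \<in> sets borel" using Q(1) by (auto simp: fmeasurable_def)
    have Qv: "{x. 1 \<le> v x} \<inter> Q \<in> fmeasurable lborel"
      by (rule fmeasurableI2[OF Q(1)]) auto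
    have rare: "measure lborel S \<le> \<mu> * s ^ N"
      if S: "S \<in> sets borel" "S \<subseteq> Q" "S \<inter> {x. 1 \<le> v x} = {}" for S
    proof -
      have Sf: "S \<in> fmeasurable lborel" by (rule fmeasurableI2[OF Q(1)]) (use S in auto)
      have "measure lborel ({x. 1 \<le> v x} \<inter> Q) + measure lborel S = measure lborel (({x. 1 \<le> v x} \<inter> Q) \<union> S)"
      proof -
        have "({x. 1 \<le> v x} \<inter> Q) \<inter> S = {}" using S(3) by blast
        then show ?thesis using measure_Un3[OF Qv Sf] by simp
      qed
      also have "\<dots> \<le> measure lborel Q"
        by (rule measure_mono_fmeasurable[OF _ _ Q(1)]) (use S in auto)
      finally show ?thesis using dense Q(3) by (simp add: algebra_simps)
    qed
    show ?thesis
    proof (cases "s0 \<le> s")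
      case True
      have K0: "0 < 2 * K" using K by simp
      \<comment> \<open>The factor 2 * K places the low set of \<open>contact_density\<close> inside
        {v \<le> 1 / 2}, which is disjoint from {1 \<le> v} and therefore rare in Q.\<close>
      have sup': "supersolution (1 - \<beta>) \<beta> \<nu> (2 * K * g) (ball y (2 * D * s + B)) (\<lambda>x. 2 * K * v x)"
        by (rule supersolution_scale[OF sup K0])
      have "2 * K * g \<le> 2 * K * (\<kappa> / s\<^sup>2)" using g K0 by (intro mult_left_mono) auto
      also have "\<dots> = 2 * K * \<kappa> / s\<^sup>2" by simp
      finally have Kg: "2 * K * g \<le> 2 * K * \<kappa> / s\<^sup>2" .
      have "2 * K * \<kappa> \<le> 16" "2 * K * \<kappa> \<le> 16 * \<kappa>1"
        using K by (auto simp: \<kappa>_def min_def field_simps)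
      then have Kg': "2 * K * g \<le> 1 / (s / 4)\<^sup>2" "2 * K * g \<le> \<kappa>1 / (s / 4)\<^sup>2"
        using order_trans[OF Kg divide_right_mono, of "16"] order_trans[OF Kg divide_right_mono, of "16 * \<kappa>1"]
        by (auto simp: power_divide mult.commute)
      have low: "1 \<le> 2 * K * v x0" if x0: "x0 \<in> ball y (s / 4)" for x0
      proof (rule ccontr)
        assume neg: "\<not> 1 \<le> 2 * K * v x0"
        have sub: "ball x0 (s / 4) \<subseteq> ball y (s / 2)" "ball x0 (2 * (s / 4)) \<subseteq> ball y (2 * D * s + B)"
          "ball x0 (s / 4) \<subseteq> ball y (2 * D * s + B)"
        proof -
          obtain t where t: "t = 2 * D * s" "s \<le> t" using sDs s by auto
          show "ball x0 (s / 4) \<subseteq> ball y (s / 2)" "ball x0 (2 * (s / 4)) \<subseteq> ball y (2 * D * s + B)"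
            "ball x0 (s / 4) \<subseteq> ball y (2 * D * s + B)"
            using x0 s t(2) B\<Lambda> \<Lambda> unfolding t(1)[symmetric]
            by (auto simp: ball_subset_ball_iff dist_commute)
        qed
        have "\<mu>1 * (s / 4) ^ N \<le> measure lborel ({x. 2 * K * v x \<le> K} \<inter> ball x0 (s / 4))"
        proof (rule density[OF cen _ Kg'(1)])
          show "supersolution (1 - \<beta>) \<beta> \<nu> (2 * K * g) (ball x0 (s / 4)) (\<lambda>x. 2 * K * v x)"
            by (rule supersolution_subset[OF sup' sub(3)])
          show "\<forall>x\<in>ball x0 (2 * (s / 4)). 0 \<le> 2 * K * v x"
            using nn sub(2) K0 by fastforce
        qed (use s0 True neg in auto)
        also have "\<dots> \<le> \<mu> * s ^ N"
          by (rule rare) (use sub Q(2) K in \<open>auto simp: field_simps\<close>)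
        finally have "\<mu>1 * (1 / 4) ^ N * s ^ N \<le> \<mu> * s ^ N" by (simp add: power_divide)
        then show False using \<mu>(3) s by simp
      qed
      have "\<forall>x\<in>ball y (4 * D * (s / 4)). c1 \<le> 2 * K * v x"
      proof (rule spread[OF cen _ Kg'(2)])
        show "supersolution (1 - \<beta>) \<beta> \<nu> (2 * K * g) (ball y (2 * (4 * D) * (s / 4))) (\<lambda>x. 2 * K * v x)"
          by (rule supersolution_subset[OF sup']) (use B\<Lambda> \<Lambda> in \<open>auto simp: ball_subset_ball_iff\<close>)
        show "\<forall>x\<in>ball y (2 * (4 * D) * (s / 4) + \<Lambda>). 0 \<le> 2 * K * v x"
          using nn B\<Lambda> K0 by auto
      qed (use low s0 True in auto)
      then have "c1 \<le> 2 * K * v x" using x by simp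
      then have "c1 / (2 * K) \<le> v x" using K by (simp add: field_simps)
      then show ?thesis by (simp add: c_def)
    next
      case False
      \<comment> \<open>As r \<le> h / 2, \<open>ball y r\<close> lies in Q; as r \<le> 1 / 4, it
        lies in the unit ball around each point of \<open>ball y (1 / 4)\<close>. One average thus
        gives the starting bound for the chain.\<close>
      have "\<omega> * r ^ N = measure lborel (ball y r)"
        using content_ball_conv_unit_ball[of r y] r by (simp add: \<omega>_def N_def)
      also have "\<dots> = measure lborel (({x. 1 \<le> v x} \<inter> ball y r) \<union> ({x. v x < 1} \<inter> ball y r))"
        by (rule arg_cong[where f="measure lborel"]) auto
      also have "\<dots> \<le> measure lborel ({x. 1 \<le> v x} \<inter> ball y r) + measure lborel ({x. v x < 1} \<inter> ball y r)"
        by (rule measure_Un_le) auto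
      also have "measure lborel ({x. v x < 1} \<inter> ball y r) \<le> \<mu> * s ^ N"
        by (rule rare) (use Q(2) r hs in \<open>auto simp: subset_iff\<close>)
      also have "\<dots> \<le> \<omega> * (r / s0) ^ N / 2 * s0 ^ N"
        using \<mu> False s by (intro mult_mono power_mono) auto
      also have "\<dots> = \<omega> * r ^ N / 2"
        using s0 by (simp add: power_divide)
      finally have vol: "r ^ N / 2 \<le> measure lborel ({x. 1 \<le> v x} \<inter> ball y r) / \<omega>"
        using \<omega> by (simp add: field_simps)
      have unit: "1 \<le> 1 / c2 * v z" if z: "z \<in> ball y (1 / 4)" for z
      proof -
        have "\<beta> * 1 * (measure lborel ({x. 1 \<le> v x} \<inter> ball y r) / \<omega>) - g \<le> v z"
          unfolding \<omega>_def
        proof (rule supersolution_measure_bound[OF \<Lambda> \<beta> cen[rule_format] sup])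
          have "1 / 4 \<le> B" using B\<Lambda> \<Lambda> by simp
          moreover have "0 \<le> 2 * D * s" using s D by simp
          ultimately have "dist y z < 2 * D * s + B" using z unfolding mem_ball by linarith
          then show "z \<in> ball y (2 * D * s + B)" by simp
          show "{x. 1 \<le> v x} \<inter> ball y r \<subseteq> ball z 1"
          proof -
            have "ball y r \<subseteq> ball z 1" using r z by (simp add: ball_subset_ball_iff)
            then show ?thesis by blast
          qed
          show "0 \<le> v x'" if "x' \<in> ball z \<Lambda>" for x'
          proof -
            have "dist y x' < 1 / 4 + \<Lambda>" using that z dist_triangle[of y x' z] by simp
            also have "\<dots> \<le> 2 * D * s + B" using s D by (simp add: B_def field_simps add_increasing)
            finally show ?thesis using nn by simp
          qed
        qed auto
        moreover have "\<beta> * (r ^ N / 2) \<le> \<beta> * (measure lborel ({x. 1 \<le> v x} \<inter> ball y r) / \<omega>)"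
          using vol \<beta> by (intro mult_left_mono) auto
        moreover have "g \<le> c2" using g(2) by (simp add: \<kappa>_def)
        ultimately have "c2 \<le> v z" by (simp add: c2_def)
        then show ?thesis using c23 by (simp add: field_simps)
      qed
      have B_ball: "ball y (real (J + 1) / 4 + \<Lambda>) \<subseteq> ball y (2 * D * s + B)"
      proof (rule subset_ball)
        have "0 \<le> 2 * D * s" using s D by simp
        then show "real (J + 1) / 4 + \<Lambda> \<le> 2 * D * s + B" by (simp add: B_def)
      qed
      have "c3 ^ J \<le> 1 / c2 * v x"
      proof (rule unit_scale_chain[OF \<Lambda> \<beta> cen[rule_format] c3_def[unfolded N_def]])
        have "g \<le> c2 * c3 ^ J" using g(2) by (simp add: \<kappa>_def)
        then show "1 / c2 * g \<le> c3 ^ J" using c23 by (simp add: field_simps)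
        show "supersolution (1 - \<beta>) \<beta> \<nu> (1 / c2 * g) (ball y (real (J + 1) / 4)) (\<lambda>x. 1 / c2 * v x)"
        proof (rule supersolution_scale[OF supersolution_subset[OF sup]])
          show "ball y (real (J + 1) / 4) \<subseteq> ball y (2 * D * s + B)"
            by (rule order_trans[OF subset_ball B_ball]) (use \<Lambda> in simp)
        qed (use c23 in simp)
        show "0 \<le> 1 / c2 * v z" if "z \<in> ball y (real (J + 1) / 4 + \<Lambda>)" for z
          using that B_ball nn c23 by auto
        have "D * s \<le> D * s0" using False D by simp
        then show "x \<in> ball y (real (J + 1) / 4)" using x J by simp
      qed (use unit in blast)
      then have "c2 * c3 ^ J \<le> v x" using c23 by (simp add: field_simps)
      then show ?thesis by (simp add: c_def)
    qed
  qed
  moreover have "0 < c" "0 < \<kappa>" "0 < B"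
    using c1 K c23 \<kappa>1 \<Lambda> by (auto simp: c_def \<kappa>_def B_def add_nonneg_pos)
  ultimately show ?thesis
    using \<mu>(1,2) unfolding N_def
    by - (rule exI[of _ B], rule conjI, assumption, rule exI[of _ \<mu>], rule conjI, assumption,
        rule exI[of _ c], rule conjI, assumption, rule exI[of _ \<kappa>], rule conjI, assumption,
        rule conjI, assumption, blast)
qed

section \<open>Dyadic cubes\<close>

text \<open>Half-open, so that the dyadic children partition a cube exactly and measures add up
  without discarding faces.\<close>

definition cube :: "'a::euclidean_space \<Rightarrow> real \<Rightarrow> 'a set" where
  "cube a s = {x. \<forall>i\<in>Basis. a \<bullet> i \<le> x \<bullet> i \<and> x \<bullet> i < a \<bullet> i + s}"

lemma inner_sum_Basis_subset:
  assumes "T \<subseteq> Basis" "i \<in> Basis"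
  shows "\<Sum>T \<bullet> (i::'a::euclidean_space) = (if i \<in> T then 1 else 0)"
proof -
  have "finite T" using assms(1) by (rule finite_subset) simp
  have "\<Sum>T \<bullet> i = (\<Sum>b\<in>T. if b = i then 1 else 0)"
    unfolding inner_sum_left using assms by (intro sum.cong) (auto simp: inner_Basis)
  also have "\<dots> = (if i \<in> T then 1 else 0)"
    using \<open>finite T\<close> by (simp add: sum.delta)
  finally show ?thesis .
qed

lemma cube_borel [measurable]: "cube a s \<in> sets borel"
  unfolding cube_def by measurable

lemma cube_subset_cbox: "cube a s \<subseteq> cbox a (a + s *\<^sub>R One)"
  by (auto simp: cube_def mem_box inner_add_left less_imp_le)

lemma box_subset_cube: "box a (a + s *\<^sub>R One) \<subseteq> cube a s"
  by (auto simp: cube_def mem_box inner_add_left less_imp_le)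

lemma bounded_cube: "bounded (cube a s)"
  using bounded_subset[OF bounded_cbox cube_subset_cbox] .

lemma cube_fmeasurable: "cube a s \<in> fmeasurable lborel"
  by (rule bounded_borel_fmeasurable) (auto simp: bounded_cube)

lemma measure_cube:
  assumes "0 \<le> s"
  shows "measure lborel (cube (a::'a::euclidean_space) s) = s ^ DIM('a)"
proof (rule antisym)
  have "measure lborel (cube a s) \<le> measure lborel (cbox a (a + s *\<^sub>R One))"
    by (rule measure_mono_fmeasurable[OF cube_subset_cbox]) auto
  also have "\<dots> = s ^ DIM('a)"
    using assms by (subst measure_lborel_cbox) (auto simp: inner_add_left)
  finally show "measure lborel (cube a s) \<le> s ^ DIM('a)" .
  have "s ^ DIM('a) = measure lborel (box a (a + s *\<^sub>R One))"
    using assms by (subst measure_lborel_box) (auto simp: inner_add_left)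
  also have "\<dots> \<le> measure lborel (cube a s)"
    by (rule measure_mono_fmeasurable[OF box_subset_cube]) (auto simp: cube_fmeasurable)
  finally show "s ^ DIM('a) \<le> measure lborel (cube a s)" .
qed

lemma ball_subset_cube: "ball (a + (s / 2) *\<^sub>R One) (s / 2) \<subseteq> cube (a::'a::euclidean_space) s"
proof
  fix x assume x: "x \<in> ball (a + (s / 2) *\<^sub>R One) (s / 2)"
  show "x \<in> cube a s"
    unfolding cube_def
  proof (intro CollectI ballI)
    fix i :: 'a assume i: "i \<in> Basis"
    have "\<bar>(x - (a + (s / 2) *\<^sub>R One)) \<bullet> i\<bar> \<le> norm (x - (a + (s / 2) *\<^sub>R One))"
      using i by (rule Basis_le_norm)
    also have "\<dots> < s / 2" using x by (simp add: dist_norm norm_minus_commute)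
    finally show "a \<bullet> i \<le> x \<bullet> i \<and> x \<bullet> i < a \<bullet> i + s"
      using i by (simp add: inner_diff_left inner_add_left abs_less_iff field_simps)
  qed
qed

lemma dist_cube_le:
  fixes x y :: "'a::euclidean_space" and s :: real
  assumes "x \<in> cube a s" "y \<in> cube a s"
  shows "dist x y \<le> DIM('a) * s"
proof -
  have "norm (x - y) \<le> (\<Sum>i\<in>Basis. \<bar>(x - y) \<bullet> i\<bar>)"
    by (rule norm_le_l1)
  also have "\<dots> \<le> (\<Sum>i\<in>(Basis::'a set). s)"
    using assms by (intro sum_mono) (force simp: cube_def inner_diff_left)
  finally show ?thesis by (simp add: dist_norm)
qed

text \<open>The \<open>2 ^ DIM('a)\<close> dyadic children of \<open>cube a s\<close> are indexed by the subsets \<open>T\<close> of \<open>Basis\<close>.\<close>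

definition child_corner :: "'a::euclidean_space \<Rightarrow> real \<Rightarrow> 'a set \<Rightarrow> 'a" where
  "child_corner a s T = a + (s / 2) *\<^sub>R \<Sum>T"

lemma child_corner_inner:
  "T \<subseteq> Basis \<Longrightarrow> i \<in> Basis \<Longrightarrow> child_corner a s T \<bullet> i = a \<bullet> i + (if i \<in> T then s / 2 else 0)"
  by (simp add: child_corner_def inner_add_left inner_sum_Basis_subset)

lemma child_subset_cube:
  assumes "0 \<le> s" "T \<subseteq> Basis"
  shows "cube (child_corner a s T) (s / 2) \<subseteq> cube a s"
proof
  fix x assume x: "x \<in> cube (child_corner a s T) (s / 2)"
  have "a \<bullet> i \<le> x \<bullet> i \<and> x \<bullet> i < a \<bullet> i + s" if "i \<in> Basis" for i
  proof -
    have "child_corner a s T \<bullet> i \<le> x \<bullet> i \<and> x \<bullet> i < child_corner a s T \<bullet> i + s / 2"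
      using x that by (simp add: cube_def)
    then show ?thesis
      using assms that by (auto simp: child_corner_inner split: if_splits)
  qed
  then show "x \<in> cube a s" by (simp add: cube_def)
qed

lemma cube_eq_Union_children:
  assumes "0 < s"
  shows "cube (a::'a::euclidean_space) s = (\<Union>T\<in>Pow Basis. cube (child_corner a s T) (s / 2))"
proof
  show "cube a s \<subseteq> (\<Union>T\<in>Pow Basis. cube (child_corner a s T) (s / 2))"
  proof
    fix x assume x: "x \<in> cube a s"
    define T where "T = {i\<in>Basis. a \<bullet> i + s / 2 \<le> x \<bullet> i}"
    have T: "T \<subseteq> Basis" by (auto simp: T_def)
    have "x \<in> cube (child_corner a s T) (s / 2)"
      using x T by (auto simp: cube_def child_corner_inner) (auto simp: T_def)
    then show "x \<in> (\<Union>T\<in>Pow Basis. cube (child_corner a s T) (s / 2))" using T by blast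
  qed
  show "(\<Union>T\<in>Pow Basis. cube (child_corner a s T) (s / 2)) \<subseteq> cube a s"
    using assms by (intro UN_least child_subset_cube) auto
qed

lemma disjnt_children:
  assumes s: "0 < s" and T: "T \<subseteq> Basis" "T' \<subseteq> Basis" "T \<noteq> T'"
  shows "disjnt (cube (child_corner (a::'a::euclidean_space) s T) (s / 2)) (cube (child_corner a s T') (s / 2))"
proof -
  obtain i where i: "i \<in> Basis" "(i \<in> T) \<noteq> (i \<in> T')" using T by blast
  have False if "x \<in> cube (child_corner a s T) (s / 2)" "x \<in> cube (child_corner a s T') (s / 2)" for x
  proof -
    have "(child_corner a s T) \<bullet> i \<le> x \<bullet> i \<and> x \<bullet> i < (child_corner a s T) \<bullet> i + s / 2"
      "(child_corner a s T') \<bullet> i \<le> x \<bullet> i \<and> x \<bullet> i < (child_corner a s T') \<bullet> i + s / 2"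
      using that i by (auto simp: cube_def)
    then show False
      using i T s by (auto simp: child_corner_inner split: if_splits)
  qed
  then show ?thesis by (auto simp: disjnt_iff)
qed

lemma measure_cube_children:
  fixes a :: "'a::euclidean_space"
  assumes s: "0 < s" and [measurable]: "E \<in> sets borel"
  shows "measure lborel (E \<inter> cube a s) =
    (\<Sum>T\<in>Pow Basis. measure lborel (E \<inter> cube (child_corner a s T) (s / 2)))"
proof -
  have "E \<inter> cube a s = (\<Union>T\<in>Pow Basis. E \<inter> cube (child_corner a s T) (s / 2))"
    unfolding cube_eq_Union_children[OF s, of a] by blast
  also have "measure lborel \<dots> = (\<Sum>T\<in>Pow Basis. measure lborel (E \<inter> cube (child_corner a s T) (s / 2)))"
  proof (rule measure_UNION')
    show "pairwise (\<lambda>T T'. disjnt (E \<inter> cube (child_corner a s T) (s / 2)) (E \<inter> cube (child_corner a s T') (s / 2)))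
      (Pow Basis)"
      using disjnt_children[OF s, of _ _ a] by (auto simp: pairwise_def disjnt_iff)
    show "E \<inter> cube (child_corner a s T) (s / 2) \<in> fmeasurable lborel" for T
      by (rule fmeasurableI2[OF cube_fmeasurable]) auto
  qed simp
  finally show ?thesis .
qed

text \<open>
  The decomposition stops at cubes of side \<open>h\<close>; those in which \<open>E\<close> has low density account for the
  error term.
\<close>
lemma calderon_zygmund:
  fixes a :: "'a::euclidean_space"
  assumes h: "0 < h" and \<theta>: "0 \<le> \<theta>" and \<mu>: "\<mu> \<le> 1"
    and [measurable]: "E \<in> sets borel" "F \<in> sets borel"
    and parent: "\<And>a' s' T. \<lbrakk>h \<le> s' / 2; cube a' s' \<subseteq> cube a (2 ^ L * h); T \<subseteq> Basis;
        (1 - \<mu>) * (s' / 2) ^ DIM('a) \<le> measure lborel (E \<inter> cube (child_corner a' s' T) (s' / 2))\<rbrakk> \<Longrightarrow> cube a' s' \<subseteq> F"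
    and leaf: "\<And>a'. \<lbrakk>cube a' h \<subseteq> cube a (2 ^ L * h); \<theta> * h ^ DIM('a) \<le> measure lborel (E \<inter> cube a' h)\<rbrakk> \<Longrightarrow> cube a' h \<subseteq> F"
    and sparse: "measure lborel (E \<inter> cube a (2 ^ L * h)) < (1 - \<mu>) * (2 ^ L * h) ^ DIM('a)"
  shows "measure lborel (E \<inter> cube a (2 ^ L * h)) \<le>
    (1 - \<mu>) * measure lborel (F \<inter> cube a (2 ^ L * h)) + \<theta> * (2 ^ L * h) ^ DIM('a)"
  using parent leaf sparse
proof (induction L arbitrary: a)
  case 0
  show ?case
  proof (cases "\<theta> * h ^ DIM('a) \<le> measure lborel (E \<inter> cube a h)")
    case True
    then have "cube a h \<subseteq> F" using "0.prems"(2) by simp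
    then have "F \<inter> cube a h = cube a h" by blast
    then show ?thesis
      using "0.prems"(3) h mult_nonneg_nonneg[OF \<theta>, of "h ^ DIM('a)"] by (simp add: measure_cube)
  next
    case False
    moreover have "0 \<le> (1 - \<mu>) * measure lborel (F \<inter> cube a h)" using \<mu> by simp
    ultimately show ?thesis unfolding power_0 mult_1 by linarith
  qed
next
  case (Suc L)
  define s where "s = 2 ^ Suc L * h"
  have s: "0 < s" "s / 2 = 2 ^ L * h" "h \<le> s / 2" using h by (auto simp: s_def)
  let ?Q = "\<lambda>T. cube (child_corner a s T) (s / 2)"
  show ?case
  \<comment> \<open>Recursion replaces the selection of maximal cubes. If some child is dense, the
    whole parent lies in F and its own sparseness is the estimate; otherwise every child is sparse
    and the estimates for the children are summed.\<close>
  proof (cases "\<exists>T\<in>Pow Basis. (1 - \<mu>) * (s / 2) ^ DIM('a) \<le> measure lborel (E \<inter> ?Q T)")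
    case True
    then have "cube a s \<subseteq> F"
      using Suc.prems(1)[of s a, folded s_def] s(3) by blast
    then have "F \<inter> cube a s = cube a s" by blast
    then show ?thesis
      using Suc.prems(3) s mult_nonneg_nonneg[OF \<theta>, of "s ^ DIM('a)"]
      unfolding s_def[symmetric] by (simp add: measure_cube)
  next
    case False
    have IH: "measure lborel (E \<inter> ?Q T) \<le> (1 - \<mu>) * measure lborel (F \<inter> ?Q T) + \<theta> * (s / 2) ^ DIM('a)"
      if T: "T \<in> Pow Basis" for T
    proof -
      have sub: "?Q T \<subseteq> cube a s" using child_subset_cube[of s T a] T s by auto
      show ?thesis
        unfolding s(2)
      proof (rule Suc.IH)
        fix a' s' T'
        assume "h \<le> s' / 2" "cube a' s' \<subseteq> cube (child_corner a s T) (2 ^ L * h)" "T' \<subseteq> Basis"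
          "(1 - \<mu>) * (s' / 2) ^ DIM('a) \<le> measure lborel (E \<inter> cube (child_corner a' s' T') (s' / 2))"
        then show "cube a' s' \<subseteq> F"
          using sub Suc.prems(1)[of s' a' T'] unfolding s(2) s_def[symmetric] by blast
      next
        fix a'
        assume "cube a' h \<subseteq> cube (child_corner a s T) (2 ^ L * h)"
          "\<theta> * h ^ DIM('a) \<le> measure lborel (E \<inter> cube a' h)"
        then show "cube a' h \<subseteq> F"
          using sub Suc.prems(2)[of a'] unfolding s(2) s_def[symmetric] by blast
      next
        show "measure lborel (E \<inter> cube (child_corner a s T) (2 ^ L * h)) < (1 - \<mu>) * (2 ^ L * h) ^ DIM('a)"
          using False T unfolding s(2)[symmetric] by (meson not_le)
      qed
    qed
    have "measure lborel (E \<inter> cube a s) = (\<Sum>T\<in>Pow Basis. measure lborel (E \<inter> ?Q T))"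
      by (rule measure_cube_children[OF s(1)]) simp
    also have "\<dots> \<le> (\<Sum>T\<in>Pow Basis. (1 - \<mu>) * measure lborel (F \<inter> ?Q T) + \<theta> * (s / 2) ^ DIM('a))"
      by (intro sum_mono IH)
    also have "\<dots> = (1 - \<mu>) * measure lborel (F \<inter> cube a s) + 2 ^ DIM('a) * (\<theta> * (s / 2) ^ DIM('a))"
      by (simp add: sum.distrib sum_distrib_left[symmetric] measure_cube_children[OF s(1)] card_Pow)
    also have "2 ^ DIM('a) * (\<theta> * (s / 2) ^ DIM('a)) = \<theta> * s ^ DIM('a)"
      by (simp add: power_divide)
    finally show ?thesis by (simp only: s_def)
  qed
qed

section \<open>The weak Harnack inequality\<close>

lemma norm_le_centred_cube:
  fixes x :: "'a::euclidean_space" and R :: real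
  assumes "x \<in> cube (- R *\<^sub>R One) (2 * R)"
  shows "norm x \<le> DIM('a) * R"
proof -
  have "norm x \<le> (\<Sum>i\<in>Basis. \<bar>x \<bullet> i\<bar>)"
    by (rule norm_le_l1)
  also have "\<dots> \<le> (\<Sum>i\<in>(Basis::'a set). R)"
    using assms by (intro sum_mono) (force simp: cube_def)
  finally show ?thesis by simp
qed

lemma cube_subset_imp_le:
  fixes a :: "'a::euclidean_space"
  assumes "cube a s \<subseteq> cube b t" "0 \<le> s" "0 \<le> t"
  shows "s \<le> t"
proof -
  have "s ^ DIM('a) \<le> t ^ DIM('a)"
    using measure_mono_fmeasurable[OF assms(1) _ cube_fmeasurable] assms by (simp add: measure_cube)
  then show ?thesis
    using assms by (simp add: power_mono_iff)
qed

lemma dyadic_scale_exists: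
  fixes R h :: real
  assumes "0 < h" "h \<le> R"
  shows "\<exists>L::nat. h / 2 \<le> R / 2 ^ L \<and> R / 2 ^ L \<le> h"
proof -
  obtain n where "R / h < 2 ^ n"
    using real_arch_pow[of 2 "R / h"] by auto
  then have ex: "\<exists>n. R / 2 ^ n \<le> h"
    using assms by (intro exI[of _ n]) (simp add: field_simps)
  define L where "L = (LEAST n. R / 2 ^ n \<le> h)"
  have L: "R / 2 ^ L \<le> h"
    unfolding L_def using ex by (rule LeastI_ex)
  have "h / 2 \<le> R / 2 ^ L"
  proof (cases L)
    case 0
    then show ?thesis using assms by simp
  next
    case (Suc l)
    then have "\<not> R / 2 ^ l \<le> h"
      unfolding L_def by (metis lessI not_less_Least)
    then show ?thesis by (simp add: Suc)
  qed
  then show ?thesis using L by blast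
qed

text \<open>The same \<eta> occurs in the admissible error and in the conclusion, with \<kappa>
  chosen before \<theta>; this form lets the constant in front of R^2 in the final estimate be
  independent of \<theta>.\<close>

lemma weak_harnack:
  fixes \<Lambda> \<beta> :: real
  assumes \<Lambda>: "1 \<le> \<Lambda>" and \<beta>: "0 < \<beta>" "\<beta> \<le> 1"
  shows "\<exists>B>0. \<exists>\<kappa>>0. \<forall>\<theta>>0. \<exists>\<eta>>0. \<forall>(\<nu> :: 'a::euclidean_space \<Rightarrow> 'a measure) g v (R::real).
    (\<forall>x. centred \<Lambda> (\<nu> x)) \<longrightarrow> B \<le> R \<longrightarrow> g \<le> \<kappa> * \<eta> / R\<^sup>2 \<longrightarrow>
    supersolution (1 - \<beta>) \<beta> \<nu> g (ball 0 (14 * DIM('a) * R)) v \<longrightarrow>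
    (\<forall>x\<in>ball 0 (14 * DIM('a) * R). 0 \<le> v x) \<longrightarrow>
    \<theta> * (2 * R) ^ DIM('a) \<le> measure lborel ({x. 1 \<le> v x} \<inter> cube (- R *\<^sub>R One) (2 * R)) \<longrightarrow>
    (\<forall>x\<in>ball 0 R. \<eta> \<le> v x)"
proof -
  define N where "N = DIM('a)"
  have N: "1 \<le> real N" using DIM_positive[where 'a='a] by (simp add: N_def Suc_le_eq)
  define \<omega> where "\<omega> = measure lborel (ball (0::'a) 1)"
  have \<omega>: "0 < \<omega>" by (simp add: \<omega>_def)
  \<comment> \<open>Halving 2 * R leads to a leaf side between 1 / (8 * N) and 1 / (4 * N). Such
    leaves have diameter at most 1 / 4, so the unit ball around any of their points contains
    them.\<close>
  define h0 where "h0 = 1 / (8 * real N)"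
  have h0: "0 < h0" using N by (simp add: h0_def)
  \<comment> \<open>A parent of side s lies within N * s of the centre of each child, and D * (s /
    2) exceeds N * s.\<close>
  define D where "D = 2 * real N + 1"
  have D: "1 \<le> D" using N by (simp add: D_def)
  obtain B1 \<mu> c \<kappa>1 where B1: "0 < B1" and \<mu>: "0 < \<mu>" "\<mu> < 1" and c: "0 < c" and \<kappa>1: "0 < \<kappa>1"
    and expand: "\<And>(\<nu> :: 'a \<Rightarrow> 'a measure) g v y s Q. \<lbrakk>\<forall>x. centred \<Lambda> (\<nu> x); h0 \<le> s; g \<le> \<kappa>1 / s\<^sup>2; g \<le> \<kappa>1;
      supersolution (1 - \<beta>) \<beta> \<nu> g (ball y (2 * D * s + B1)) v; \<forall>x\<in>ball y (2 * D * s + B1). 0 \<le> v x;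
      Q \<in> fmeasurable lborel; ball y (s / 2) \<subseteq> Q; measure lborel Q = s ^ N;
      (1 - \<mu>) * s ^ N \<le> measure lborel ({x. 1 \<le> v x} \<inter> Q)\<rbrakk> \<Longrightarrow> \<forall>x\<in>ball y (D * s). c \<le> v x"
    using dense_expansion[OF \<Lambda> \<beta> D h0, where 'a='a] unfolding N_def by metis
  define B where "B = max B1 (max \<Lambda> 1)"
  define \<kappa> where "\<kappa> = min 1 (\<kappa>1 / 4)"
  have \<kappa>: "0 < \<kappa>" "\<kappa> \<le> 1" "\<kappa> \<le> \<kappa>1 / 4" using \<kappa>1 by (auto simp: \<kappa>_def)
  \<comment> \<open>Used twice: for a dense child, to cover its parent in the Calderon--Zygmund
    step, and at the end for the full cube, to reach the ball of radius R.\<close>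
  have cube_step: "c \<le> w x"
    if cen: "\<forall>x. centred \<Lambda> (\<nu> x)" and R: "B \<le> R" and g: "g \<le> \<kappa> / R\<^sup>2"
      and sup: "supersolution (1 - \<beta>) \<beta> \<nu> g (ball 0 (14 * N * R)) w"
      and nn: "\<forall>x\<in>ball 0 (14 * N * R). 0 \<le> w x"
      and b: "cube b s \<subseteq> cube (- R *\<^sub>R One) (2 * R)" and s: "h0 \<le> s"
      and dense: "(1 - \<mu>) * s ^ N \<le> measure lborel ({x. 1 \<le> w x} \<inter> cube b s)"
      and x: "dist (b + (s / 2) *\<^sub>R One) x < D * s"
    for \<nu> :: "'a \<Rightarrow> 'a measure" and g w b s x and R :: real
  proof -
    define y where "y = b + (s / 2) *\<^sub>R One"
    have R1: "1 \<le> R" "B1 \<le> R" using R by (auto simp: B_def)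
    have s0: "0 < s" using h0 s by simp
    have s2R: "s \<le> 2 * R" using cube_subset_imp_le[OF b] s0 R1 by simp
    have "y \<in> cube b s"
      using ball_subset_cube[of b s] s0 by (auto simp: y_def)
    then have y: "norm y \<le> N * R" using norm_le_centred_cube b by (auto simp: N_def)
    have "R \<le> N * R" using N R1 by simp
    have "2 * D * s \<le> 2 * D * (2 * R)" using s2R D by (intro mult_left_mono) auto
    also have "\<dots> = 8 * (N * R) + 4 * R" by (simp add: D_def algebra_simps)
    \<comment> \<open>Origin of the factor 14: the left side is at most 9 * N * R + 5 * R, and R
      \<le> N * R.\<close>
    finally have "2 * D * s + B1 + norm y \<le> 14 * (N * R)"
      using y R1 \<open>R \<le> N * R\<close> by linarith
    then have sub: "ball y (2 * D * s + B1) \<subseteq> ball 0 (14 * N * R)"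
      using s0 by (simp add: ball_subset_ball_iff)
    have "s\<^sup>2 \<le> (2 * R)\<^sup>2" using s2R s0 by (intro power_mono) auto
    then have "\<kappa>1 / (2 * R)\<^sup>2 \<le> \<kappa>1 / s\<^sup>2"
      using \<kappa>1 s0 R1 by (intro divide_left_mono) auto
    moreover have "\<kappa> / R\<^sup>2 \<le> (\<kappa>1 / 4) / R\<^sup>2"
      using \<kappa> by (intro divide_right_mono) auto
    ultimately have g1: "g \<le> \<kappa>1 / s\<^sup>2" using g by (simp add: power_mult_distrib)
    have "\<kappa> / R\<^sup>2 \<le> \<kappa> / 1" using R1 \<kappa> by (intro divide_left_mono) auto
    then have g2: "g \<le> \<kappa>1" using g \<kappa> \<kappa>1 by simp
    have "\<forall>x\<in>ball y (D * s). c \<le> w x"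
    proof (rule expand[OF cen s g1 g2 supersolution_subset[OF sup sub] _ cube_fmeasurable _ _ dense])
      show "ball y (s / 2) \<subseteq> cube b s" unfolding y_def by (rule ball_subset_cube)
      show "measure lborel (cube b s) = s ^ N" using s0 by (simp add: measure_cube N_def)
    qed (use nn sub in blast)
    then show ?thesis using x by (simp add: y_def)
  qed
  have "\<exists>\<eta>>0. \<forall>(\<nu> :: 'a \<Rightarrow> 'a measure) g v (R::real).
    (\<forall>x. centred \<Lambda> (\<nu> x)) \<longrightarrow> B \<le> R \<longrightarrow> g \<le> \<kappa> * \<eta> / R\<^sup>2 \<longrightarrow>
    supersolution (1 - \<beta>) \<beta> \<nu> g (ball 0 (14 * N * R)) v \<longrightarrow> (\<forall>x\<in>ball 0 (14 * N * R). 0 \<le> v x) \<longrightarrow>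
    \<theta> * (2 * R) ^ N \<le> measure lborel ({x. 1 \<le> v x} \<inter> cube (- R *\<^sub>R One) (2 * R)) \<longrightarrow>
    (\<forall>x\<in>ball 0 R. \<eta> \<le> v x)" if \<theta>: "0 < \<theta>" for \<theta> :: real
  proof -
    \<comment> \<open>As \<open>E j\<close> fills at least the fraction \<theta> of Q, the leaf
      error becomes at most \<mu> / 2 times the measure of \<open>E j \<inter> Q\<close>. Absorbing
      it on the left leaves the growth factor l below.\<close>
    define \<theta>' where "\<theta>' = \<theta> * \<mu> / 2"
    have \<theta>': "0 < \<theta>'" using \<theta> \<mu> by (simp add: \<theta>'_def)
    define c\<theta> where "c\<theta> = \<beta> * (\<theta>' * h0 ^ N / \<omega>) / 2"
    have c\<theta>: "0 < c\<theta>" using \<beta> \<theta>' h0 \<omega> by (simp add: c\<theta>_def)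
    define d where "d = min 1 (min c c\<theta>)"
    have d: "0 < d" "d \<le> 1" "d \<le> c" "d \<le> c\<theta>" using c c\<theta> by (auto simp: d_def)
    define l where "l = (1 - \<mu> / 2) / (1 - \<mu>)"
    have l: "1 < l" using \<mu> by (simp add: l_def)
    obtain n where "1 / \<theta> < l ^ n" using real_arch_pow[OF l] by blast
    then have n: "1 < l ^ n * \<theta>" using \<theta> by (simp add: field_simps)
    \<comment> \<open>The n rounds raise the density from \<theta> to 1 - \<mu>; the additional
      factor d pays for the final \<open>cube_step\<close> on Q.\<close>
    define \<eta> where "\<eta> = d ^ Suc n"
    have "\<eta> \<le> v x"
      if cen: "\<forall>x. centred \<Lambda> (\<nu> x)" and R: "B \<le> R" and g: "g \<le> \<kappa> * \<eta> / R\<^sup>2"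
        and sup: "supersolution (1 - \<beta>) \<beta> \<nu> g (ball 0 (14 * N * R)) v"
        and nn: "\<forall>x\<in>ball 0 (14 * N * R). 0 \<le> v x"
        and start: "\<theta> * (2 * R) ^ N \<le> measure lborel ({x. 1 \<le> v x} \<inter> cube (- R *\<^sub>R One) (2 * R))"
        and x: "x \<in> ball 0 R"
      for \<nu> :: "'a \<Rightarrow> 'a measure" and g v x and R :: real
    proof -
      have [measurable]: "v \<in> borel_measurable borel" using sup by (simp add: supersolution_def)
      have R1: "1 \<le> R" "\<Lambda> \<le> R" using R by (auto simp: B_def)
      have RN: "R \<le> N * R" using N R1 by simp
      define Q where "Q = cube (- R *\<^sub>R One :: 'a) (2 * R)"
      have Q_vol: "measure lborel Q = (2 * R) ^ N" using R1 by (simp add: Q_def measure_cube N_def)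
      have Q_norm: "norm x \<le> N * R" if "x \<in> Q" for x
        using norm_le_centred_cube that by (simp add: Q_def N_def)
      define E where "E j = {x. d ^ j \<le> v x}" for j
      have [measurable]: "E j \<in> sets borel" for j unfolding E_def by measurable
      have E_eq: "E j = {x. 1 \<le> 1 / d ^ j * v x}" for j
        using d by (auto simp: E_def field_simps)
      have E_fm: "E j \<inter> Q \<in> fmeasurable lborel" for j
        unfolding Q_def by (rule fmeasurableI2[OF cube_fmeasurable]) auto
      have E_mono: "measure lborel (E i \<inter> Q) \<le> measure lborel (E j \<inter> Q)" if "i \<le> j" for i j
      proof (rule measure_mono_fmeasurable[OF _ _ E_fm])
        show "E i \<inter> Q \<subseteq> E j \<inter> Q"
          using power_decreasing[OF that, of d] d by (auto simp: E_def)
      qed (simp add: Q_def)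
      \<comment> \<open>Dividing by d ^ j turns \<open>E j\<close> into {1 \<le> w j} but inflates
        the error. Because g is controlled by d ^ Suc n, a factor d is still to spare for every j
        \<le> n.\<close>
      define w where "w j x = 1 / d ^ j * v x" for j x
      have w_sup: "supersolution (1 - \<beta>) \<beta> \<nu> (1 / d ^ j * g) (ball 0 (14 * N * R)) (w j)" for j
        unfolding w_def by (rule supersolution_scale[OF sup]) (use d in simp)
      have w_nn: "\<forall>x\<in>ball 0 (14 * N * R). 0 \<le> w j x" for j
        using nn d by (simp add: w_def)
      have w_g: "1 / d ^ j * g \<le> \<kappa> * d / R\<^sup>2" if "j \<le> n" for j
      proof -
        have "\<eta> \<le> d ^ Suc j" unfolding \<eta>_def using d that by (intro power_decreasing) auto
        then have "\<kappa> * \<eta> / R\<^sup>2 \<le> \<kappa> * d ^ Suc j / R\<^sup>2" using \<kappa> by (intro divide_right_mono mult_left_mono) auto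
        then have "g \<le> d ^ j * (\<kappa> * d / R\<^sup>2)" using g by (simp add: mult_ac)
        then have "1 / d ^ j * g \<le> 1 / d ^ j * (d ^ j * (\<kappa> * d / R\<^sup>2))" using d by (intro mult_left_mono) auto
        then show ?thesis using d by simp
      qed
      have w_g1: "1 / d ^ j * g \<le> \<kappa> / R\<^sup>2" if "j \<le> n" for j
      proof -
        have "\<kappa> * d / R\<^sup>2 \<le> \<kappa> / R\<^sup>2" using \<kappa> d by (intro divide_right_mono) (auto simp: mult_left_le)
        then show ?thesis using w_g[OF that] by simp
      qed
      have w_g2: "1 / d ^ j * g \<le> c\<theta>" if "j \<le> n" for j
      proof -
        have "\<kappa> * d / R\<^sup>2 \<le> \<kappa> * d / 1" using \<kappa> d R1 by (intro divide_left_mono) auto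
        also have "\<dots> \<le> 1 * d" using \<kappa> d by simp
        finally show ?thesis using w_g[OF that] d by simp
      qed
      have "1 / (4 * real N) \<le> 2 * R"
      proof -
        have "1 / (4 * real N) \<le> 1 / 4" using N by (simp add: field_simps)
        then show ?thesis using R1 by simp
      qed
      then obtain L where L: "1 / (4 * real N) / 2 \<le> 2 * R / 2 ^ L" "2 * R / 2 ^ L \<le> 1 / (4 * real N)"
        using dyadic_scale_exists[of "1 / (4 * real N)" "2 * R"] N by auto
      define h where "h = 2 * R / 2 ^ L"
      have h: "0 < h" "h0 \<le> h" "h \<le> 1 / (4 * real N)" "2 ^ L * h = 2 * R"
        using L R1 by (auto simp: h_def h0_def)
      have growth: "l * measure lborel (E j \<inter> Q) \<le> measure lborel (E (Suc j) \<inter> Q)"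
        if j: "j \<le> n" and sparse: "measure lborel (E j \<inter> Q) < (1 - \<mu>) * (2 * R) ^ N" for j
      proof -
        have dle: "z \<in> E (Suc j)" if "d \<le> w j z" for z
          using that d by (simp add: E_def w_def field_simps)
        have "measure lborel (E j \<inter> cube (- R *\<^sub>R One) (2 ^ L * h)) \<le>
          (1 - \<mu>) * measure lborel (E (Suc j) \<inter> cube (- R *\<^sub>R One) (2 ^ L * h)) + \<theta>' * (2 ^ L * h) ^ DIM('a)"
        proof (rule calderon_zygmund[OF h(1)])
          fix b :: 'a and s T
          assume s: "h \<le> s / 2" and b: "cube b s \<subseteq> cube (- R *\<^sub>R One) (2 ^ L * h)" and T: "T \<subseteq> Basis"
            and dense: "(1 - \<mu>) * (s / 2) ^ DIM('a) \<le> measure lborel (E j \<inter> cube (child_corner b s T) (s / 2))"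
          have s0: "0 < s" "h0 \<le> s / 2" using s h by auto
          have sub: "cube (child_corner b s T) (s / 2) \<subseteq> cube b s"
            using child_subset_cube T s0 by (metis less_imp_le)
          show "cube b s \<subseteq> E (Suc j)"
          proof
            fix z assume z: "z \<in> cube b s"
            define y where "y = child_corner b s T + (s / 2 / 2) *\<^sub>R One"
            have "y \<in> ball y (s / 2 / 2)" using s0 by simp
            then have "y \<in> cube b s"
              using ball_subset_cube[of "child_corner b s T" "s / 2"] sub unfolding y_def by blast
            then have "dist y z \<le> N * s" using dist_cube_le[OF _ z] by (simp add: N_def)
            also have "\<dots> < D * (s / 2)" using s0 by (simp add: D_def algebra_simps)
            finally have "dist y z < D * (s / 2)" .
            then have "c \<le> w j z"
              unfolding y_def
            proof (intro cube_step[OF cen R w_g1[OF j] w_sup w_nn _ s0(2)])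
              show "cube (child_corner b s T) (s / 2) \<subseteq> cube (- R *\<^sub>R One) (2 * R)"
                using sub b h(4) by simp
              show "(1 - \<mu>) * (s / 2) ^ N \<le> measure lborel ({x. 1 \<le> w j x} \<inter> cube (child_corner b s T) (s / 2))"
                using dense unfolding E_eq w_def N_def .
            qed
            then show "z \<in> E (Suc j)" using d by (intro dle) simp
          qed
        next
          fix b :: 'a
          assume b: "cube b h \<subseteq> cube (- R *\<^sub>R One) (2 ^ L * h)"
            and dense: "\<theta>' * h ^ DIM('a) \<le> measure lborel (E j \<inter> cube b h)"
          show "cube b h \<subseteq> E (Suc j)"
          proof
            fix z assume z: "z \<in> cube b h"
            then have zn: "norm z \<le> N * R" using b Q_norm h(4) by (auto simp: Q_def)
            have "\<beta> * 1 * (measure lborel (E j \<inter> cube b h) / \<omega>) - 1 / d ^ j * g \<le> w j z"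
              unfolding \<omega>_def
            proof (rule supersolution_measure_bound[OF \<Lambda> \<beta> cen[rule_format] w_sup])
              have "norm z < 14 * (N * R)" using zn RN R1 by linarith
              then show "z \<in> ball 0 (14 * N * R)" by simp
              show "0 \<le> w j z'" if "z' \<in> ball z \<Lambda>" for z'
              proof -
                have "norm z' \<le> norm z + dist z z'"
                  using norm_triangle_sub[of z' z] by (simp add: dist_norm norm_minus_commute)
                moreover have "dist z z' < \<Lambda>" using that by simp
                ultimately have "norm z' < 14 * (N * R)" using zn RN R1 by linarith
                then show ?thesis using w_nn by simp
              qed
              show "E j \<inter> cube b h \<subseteq> ball z 1"
              proof
                fix z' assume "z' \<in> E j \<inter> cube b h"
                then have "dist z z' \<le> N * h" using dist_cube_le[OF z, of z'] by (simp add: N_def)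
                also have "\<dots> \<le> N * (1 / (4 * real N))" using h N by (intro mult_left_mono) auto
                also have "\<dots> < 1" using N by simp
                finally show "z' \<in> ball z 1" by simp
              qed
              show "1 \<le> w j z'" if "z' \<in> E j \<inter> cube b h" for z'
                using that unfolding E_eq w_def by simp
            qed simp
            moreover have "\<beta> * (\<theta>' * h0 ^ N / \<omega>) \<le> \<beta> * (measure lborel (E j \<inter> cube b h) / \<omega>)"
            proof -
              have "\<theta>' * h0 ^ N \<le> \<theta>' * h ^ N" using \<theta>' h h0 by (intro mult_left_mono power_mono) auto
              also have "\<dots> \<le> measure lborel (E j \<inter> cube b h)" using dense by (simp add: N_def)
              finally show ?thesis using \<beta> \<omega> by (intro mult_left_mono divide_right_mono) auto
            qed
            ultimately have "c\<theta> \<le> w j z" using w_g2[OF j] by (simp add: c\<theta>_def)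
            then show "z \<in> E (Suc j)" using d by (intro dle) simp
          qed
        next
          show "measure lborel (E j \<inter> cube (- R *\<^sub>R One) (2 ^ L * h)) < (1 - \<mu>) * (2 ^ L * h) ^ DIM('a)"
            using sparse unfolding h(4) Q_def N_def .
        qed (use \<theta>' \<mu> in auto)
        then have "measure lborel (E j \<inter> Q) \<le> (1 - \<mu>) * measure lborel (E (Suc j) \<inter> Q) + \<theta>' * (2 * R) ^ N"
          unfolding h(4) Q_def N_def .
        moreover have "\<theta>' * (2 * R) ^ N \<le> \<mu> / 2 * measure lborel (E j \<inter> Q)"
        proof -
          have "\<theta> * (2 * R) ^ N \<le> measure lborel (E j \<inter> Q)"
            using start E_mono[of 0 j] by (simp add: E_def Q_def)
          then have "\<mu> / 2 * (\<theta> * (2 * R) ^ N) \<le> \<mu> / 2 * measure lborel (E j \<inter> Q)"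
            using \<mu> by (intro mult_left_mono) auto
          then show ?thesis by (simp add: \<theta>'_def mult_ac)
        qed
        ultimately have "(1 - \<mu> / 2) * measure lborel (E j \<inter> Q) \<le> (1 - \<mu>) * measure lborel (E (Suc j) \<inter> Q)"
          by (simp add: algebra_simps)
        then show ?thesis using \<mu> by (simp add: l_def field_simps)
      qed
      \<comment> \<open>The minimum records an alternative: the measure gains the factor l until
        density 1 - \<mu> is reached, and from then on monotonicity of \<open>E\<close> preserves
        that density.\<close>
      have "min ((1 - \<mu>) * (2 * R) ^ N) (l ^ j * \<theta> * (2 * R) ^ N) \<le> measure lborel (E j \<inter> Q)" if "j \<le> n" for j
        using that
      proof (induction j)
        case 0
        then show ?case using start by (simp add: E_def Q_def)
      next
        case (Suc j)
        show ?case
        proof (cases "measure lborel (E j \<inter> Q) < (1 - \<mu>) * (2 * R) ^ N")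
          case True
          then have "l ^ j * \<theta> * (2 * R) ^ N \<le> measure lborel (E j \<inter> Q)" using Suc by simp
          then have "l * (l ^ j * \<theta> * (2 * R) ^ N) \<le> l * measure lborel (E j \<inter> Q)"
            using l by (intro mult_left_mono) auto
          also have "\<dots> \<le> measure lborel (E (Suc j) \<inter> Q)"
            using growth True Suc.prems by simp
          finally show ?thesis by (simp add: mult_ac min_le_iff_disj)
        next
          case False
          then show ?thesis using E_mono[of j "Suc j"] by simp
        qed
      qed
      from this[of n] have "min ((1 - \<mu>) * (2 * R) ^ N) (l ^ n * \<theta> * (2 * R) ^ N) \<le> measure lborel (E n \<inter> Q)"
        by simp
      moreover have "(1 - \<mu>) * (2 * R) ^ N \<le> l ^ n * \<theta> * (2 * R) ^ N"
        using n \<mu> R1 by (intro mult_right_mono) auto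
      ultimately have dense: "(1 - \<mu>) * (2 * R) ^ N \<le> measure lborel (E n \<inter> Q)" by simp
      have "c \<le> w n x"
      proof (rule cube_step[OF cen R w_g1 w_sup w_nn order_refl])
        show "h0 \<le> 2 * R"
        proof -
          have "h0 \<le> 1" using N by (simp add: h0_def field_simps)
          then show ?thesis using R1 by simp
        qed
        show "(1 - \<mu>) * (2 * R) ^ N \<le> measure lborel ({x. 1 \<le> w n x} \<inter> cube (- R *\<^sub>R One) (2 * R))"
          using dense unfolding E_eq w_def Q_def .
        have "R \<le> D * (2 * R)" using D R1 mult_mono[of 1 D R "2 * R"] by simp
        then show "dist (- R *\<^sub>R One + (2 * R / 2) *\<^sub>R One) x < D * (2 * R)" using x by simp
      qed simp
      then have "d ^ n * c \<le> v x" using d by (simp add: w_def field_simps)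
      moreover have "d ^ n * d \<le> d ^ n * c" using d by (intro mult_left_mono) auto
      ultimately show ?thesis by (simp add: \<eta>_def mult.commute)
    qed
    moreover have "0 < \<eta>" using d by (simp add: \<eta>_def)
    ultimately show ?thesis by - (rule exI[of _ \<eta>], rule conjI, assumption, blast)
  qed
  moreover have "0 < B" by (simp add: B_def)
  ultimately show ?thesis
    using \<kappa>(1) unfolding N_def
    by - (rule exI[of _ B], rule conjI, assumption, rule exI[of _ \<kappa>], rule conjI, assumption, blast)
qed

section \<open>Rescaling\<close>

text \<open>The complement of the support is a union of null open sets; by Lindelof countably many
  of them suffice, so the union is null.\<close>

lemma AE_measure_support:
  fixes \<mu> :: "'a::euclidean_space measure"
  assumes "sets \<mu> = sets borel"
  shows "AE z in \<mu>. z \<in> measure_support \<mu>"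
proof -
  define \<F> where "\<F> = {U. open U \<and> emeasure \<mu> U = 0}"
  obtain \<F>' where \<F>': "\<F>' \<subseteq> \<F>" "countable \<F>'" "\<Union>\<F>' = \<Union>\<F>"
    using Lindelof[of \<F>] by (auto simp: \<F>_def)
  have "(\<Union>U\<in>\<F>'. U) \<in> null_sets \<mu>"
    using \<F>' assms by (intro null_sets_UN') (auto simp: \<F>_def null_sets_def)
  then have "\<Union>\<F> \<in> null_sets \<mu>"
    using \<F>'(3) by simp
  then have "AE z in \<mu>. z \<notin> \<Union>\<F>"
    by (rule AE_not_in)
  then show ?thesis
    by eventually_elim (auto simp: \<F>_def measure_support_def zero_less_iff_neq_zero)
qed

lemma symmetric_prob_measures_centred:
  assumes "\<mu> \<in> symmetric_prob_measures \<Lambda>"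
  shows "centred \<Lambda> \<mu>"
proof -
  have sets: "sets \<mu> = sets borel" and prob: "prob_space \<mu>"
    and supp: "measure_support \<mu> \<subseteq> ball 0 \<Lambda>" and sym: "symmetric_measure \<mu>"
    using assms by (auto simp: symmetric_prob_measures_def radon_measure_def)
  have [measurable_cong]: "sets \<mu> = sets borel" by fact
  have "distr \<mu> borel uminus = \<mu>"
  proof (rule measure_eqI)
    fix A assume "A \<in> sets (distr \<mu> borel uminus)"
    then have A: "A \<in> sets borel" by simp
    have "uminus -` A = uminus ` A"
      by force
    then show "emeasure (distr \<mu> borel uminus) A = emeasure \<mu> A"
      using A sym sets sets_eq_imp_space_eq[OF sets] by (simp add: emeasure_distr symmetric_measure_def)
  qed (simp add: sets)
  moreover have "AE z in \<mu>. norm z < \<Lambda>"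
    by (rule eventually_mono[OF AE_measure_support[OF sets]]) (use supp in auto)
  ultimately show ?thesis
    using prob sets integral_inner_eq_0[OF sets] by (simp add: centred_def)
qed

section \<open>Affine changes of variables\<close>

lemma lborel_integral_affine:
  fixes u :: "'a::euclidean_space \<Rightarrow> real"
  assumes [measurable]: "u \<in> borel_measurable borel" and \<epsilon>: "0 < \<epsilon>"
  shows "(\<integral>y. u y \<partial>lborel) = \<epsilon> ^ DIM('a) * (\<integral>z. u (x + \<epsilon> *\<^sub>R z) \<partial>lborel)"
proof -
  have "(\<integral>y. u y \<partial>lborel) =
    (\<integral>y. u y \<partial>density (distr lborel borel (\<lambda>z. x + \<epsilon> *\<^sub>R z)) (\<lambda>_. ennreal (\<epsilon> ^ DIM('a))))"
    using lborel_affine[of \<epsilon> x] \<epsilon> by (simp add: ennreal_power)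
  also have "\<dots> = \<epsilon> ^ DIM('a) * (\<integral>z. u (x + \<epsilon> *\<^sub>R z) \<partial>lborel)"
    using \<epsilon> by (subst integral_density) (auto simp: integral_distr)
  finally show ?thesis .
qed

lemma average_eq_integral_unif:
  fixes u :: "'a::euclidean_space \<Rightarrow> real"
  assumes [measurable]: "u \<in> borel_measurable borel" and \<epsilon>: "0 < \<epsilon>"
  shows "1 / measure lborel (ball (0::'a) \<epsilon>) * (LINT y:ball x \<epsilon>|lborel. u y) =
    (\<integral>z. u (x + \<epsilon> *\<^sub>R z) \<partial>unif)"
proof -
  define \<omega> where "\<omega> = measure lborel (ball (0::'a) 1)"
  have \<omega>: "0 < \<omega>" by (simp add: \<omega>_def)
  have e\<omega>: "emeasure lborel (ball (0::'a) 1) = ennreal \<omega>"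
    using emeasure_lborel_ball_finite[of "0::'a" 1] by (simp add: \<omega>_def emeasure_eq_ennreal_measure)
  have ind: "indicator (ball x \<epsilon>) (x + \<epsilon> *\<^sub>R z) = (indicator (ball 0 1) z :: real)" for z
    using \<epsilon> by (auto simp: indicator_def dist_norm)
  have "(LINT y:ball x \<epsilon>|lborel. u y) =
      \<epsilon> ^ DIM('a) * (\<integral>z. indicator (ball x \<epsilon>) (x + \<epsilon> *\<^sub>R z) *\<^sub>R u (x + \<epsilon> *\<^sub>R z) \<partial>lborel)"
    unfolding set_lebesgue_integral_def
    by (rule lborel_integral_affine[OF _ \<epsilon>]) (intro borel_measurable_scaleR borel_measurable_indicator; simp)
  also have "\<dots> = \<epsilon> ^ DIM('a) * (\<integral>z. indicator (ball 0 1) z * u (x + \<epsilon> *\<^sub>R z) \<partial>lborel)"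
    by (simp add: ind)
  finally have 1: "(LINT y:ball x \<epsilon>|lborel. u y) =
      \<epsilon> ^ DIM('a) * (\<integral>z. indicator (ball 0 1) z * u (x + \<epsilon> *\<^sub>R z) \<partial>lborel)" .
  have "(\<lambda>z. indicator (ball (0::'a) 1) z / emeasure lborel (ball (0::'a) 1)) =
      (\<lambda>z. ennreal (indicator (ball 0 1) z / \<omega>))"
    unfolding e\<omega> using \<omega> by (auto simp: fun_eq_iff indicator_def divide_ennreal[symmetric])
  then have "(\<integral>z. u (x + \<epsilon> *\<^sub>R z) \<partial>unif) = (\<integral>z. (indicator (ball 0 1) z / \<omega>) *\<^sub>R u (x + \<epsilon> *\<^sub>R z) \<partial>lborel)"
    unfolding uniform_measure_def using \<omega> by (simp only:) (subst integral_density, auto intro!: borel_measurable_divide borel_measurable_indicator)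
  also have "\<dots> = (\<integral>z. (1 / \<omega>) * (indicator (ball 0 1) z * u (x + \<epsilon> *\<^sub>R z)) \<partial>lborel)"
    by simp
  also have "\<dots> = (1 / \<omega>) * (\<integral>z. indicator (ball 0 1) z * u (x + \<epsilon> *\<^sub>R z) \<partial>lborel)"
    by (rule integral_mult_right_zero)
  finally show ?thesis
    unfolding 1 using content_ball_conv_unit_ball[of \<epsilon> "0::'a"] \<epsilon> by (simp add: \<omega>_def)
qed

lemma measure_lborel_vimage_scaleR:
  fixes S :: "'a::euclidean_space set"
  assumes [measurable]: "S \<in> sets borel" and "0 < \<epsilon>"
  shows "measure lborel S = \<epsilon> ^ DIM('a) * measure lborel ((*\<^sub>R) \<epsilon> -` S)"
proof -
  have [measurable]: "(*\<^sub>R) \<epsilon> -` S \<in> sets borel"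
    using measurable_sets_borel[of "(*\<^sub>R) \<epsilon>" borel S] by simp
  have "(\<integral>y. indicator S y \<partial>lborel) = \<epsilon> ^ DIM('a) * (\<integral>z. indicator S (0 + \<epsilon> *\<^sub>R z) \<partial>lborel)"
    using assms by (intro lborel_integral_affine) auto
  moreover have "(\<lambda>z. indicator S (0 + \<epsilon> *\<^sub>R z) :: real) = indicator ((*\<^sub>R) \<epsilon> -` S)"
    by (auto simp: indicator_def)
  ultimately show ?thesis by simp
qed

theorem lemma5p8:
  fixes \<Lambda> \<alpha> \<beta> :: real
  assumes "\<Lambda> \<ge> 1" and "0 < \<beta>" and "\<beta> \<le> 1" and "\<alpha> = 1 - \<beta>"
  shows "\<exists>k>1. \<exists>C>0. \<exists>\<epsilon>\<^sub>0>0. \<forall>\<theta>>0. \<exists>\<eta>>0.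
    \<forall>(R::real) (\<epsilon>::real) (m::real) (M::real)
      (\<nu> :: real ^ 'n \<Rightarrow> (real ^ 'n) measure)
      (f :: real ^ 'n \<Rightarrow> real) (u :: real ^ 'n \<Rightarrow> real).
      R > 0 \<longrightarrow> 0 < \<epsilon> \<longrightarrow> \<epsilon> < \<epsilon>\<^sub>0 * R \<longrightarrow>
      admissible_family \<Lambda> \<nu> \<longrightarrow>
      bounded (f ` ball 0 (k * R)) \<longrightarrow>
      f \<in> borel_measurable (restrict_space borel (ball 0 (k * R))) \<longrightarrow>
      bounded (range u) \<longrightarrow> u \<in> borel_measurable borel \<longrightarrow>
      (\<forall>x\<in>ball 0 (k * R).
         u x \<le> \<alpha> * (\<integral>z. u (x + \<epsilon> *\<^sub>R z) \<partial>\<nu> x)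
               + \<beta> / measure lborel (ball (0 :: real ^ 'n) \<epsilon>) * (LINT y:ball x \<epsilon>|lborel. u y)
               + \<epsilon>\<^sup>2 * f x) \<longrightarrow>
      (\<forall>x\<in>ball 0 (k * R). u x \<le> M) \<longrightarrow>
      measure lborel (ball 0 R \<inter> {x. u x \<le> m}) \<ge> \<theta> * measure lborel (ball (0 :: real ^ 'n) R) \<longrightarrow>
      (SUP x\<in>ball 0 R. u x)
        \<le> (1 - \<eta>) * M + \<eta> * m + C * R\<^sup>2 * (SUP x\<in>ball 0 (k * R). \<bar>f x\<bar>)"
proof -
  define N where "N = DIM(real ^ 'n)"
  have N: "1 \<le> real N" using DIM_positive[where 'a="real ^ 'n"] unfolding N_def by linarith
  define \<omega> where "\<omega> = measure lborel (ball (0::real ^ 'n) 1)"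
  have \<omega>: "0 < \<omega>" by (simp add: \<omega>_def)
  from weak_harnack[OF assms(1-3), where 'a="real ^ 'n", folded N_def]
  obtain B \<kappa> where B: "0 < B" and \<kappa>: "0 < \<kappa>"
    and harnack: "\<And>\<theta>. 0 < \<theta> \<Longrightarrow> \<exists>\<eta>>0. \<forall>(\<nu> :: real ^ 'n \<Rightarrow> (real ^ 'n) measure) g v (R::real).
      (\<forall>x. centred \<Lambda> (\<nu> x)) \<longrightarrow> B \<le> R \<longrightarrow> g \<le> \<kappa> * \<eta> / R\<^sup>2 \<longrightarrow>
      supersolution (1 - \<beta>) \<beta> \<nu> g (ball 0 (14 * N * R)) v \<longrightarrow>
      (\<forall>x\<in>ball 0 (14 * N * R). 0 \<le> v x) \<longrightarrow>
      \<theta> * (2 * R) ^ N \<le> measure lborel ({x. 1 \<le> v x} \<inter> cube (- R *\<^sub>R One) (2 * R)) \<longrightarrow>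
      (\<forall>x\<in>ball 0 R. \<eta> \<le> v x)"
    by blast
  define k where "k = 14 * real N"
  have k: "1 < k" using N by (simp add: k_def)
  \<comment> \<open>The bound \<epsilon> < R / B says that the rescaled radius R / \<epsilon>
    exceeds B. Both B and \<kappa> are obtained before \<theta>, as the order of quantifiers
    demands.\<close>
  show ?thesis
  proof (rule exI[of _ k], rule conjI[OF k], rule exI[of _ "1 / \<kappa>"], rule conjI, use \<kappa> in simp,
      rule exI[of _ "1 / B"], rule conjI, use B in simp, intro allI impI)
    fix \<theta> :: real assume \<theta>: "0 < \<theta>"
    \<comment> \<open>The new density converts the volume \<omega> * R ^ N of the ball into the
      volume (2 * R) ^ N of the circumscribed cube.\<close>
    then have "0 < \<theta> * \<omega> / 2 ^ N" using \<omega> by simp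
    from harnack[OF this] obtain \<eta> where \<eta>: "0 < \<eta>"
      and bound: "\<forall>(\<nu> :: real ^ 'n \<Rightarrow> (real ^ 'n) measure) g v (R::real).
        (\<forall>x. centred \<Lambda> (\<nu> x)) \<longrightarrow> B \<le> R \<longrightarrow> g \<le> \<kappa> * \<eta> / R\<^sup>2 \<longrightarrow>
        supersolution (1 - \<beta>) \<beta> \<nu> g (ball 0 (14 * N * R)) v \<longrightarrow>
        (\<forall>x\<in>ball 0 (14 * N * R). 0 \<le> v x) \<longrightarrow>
        \<theta> * \<omega> / 2 ^ N * (2 * R) ^ N \<le> measure lborel ({x. 1 \<le> v x} \<inter> cube (- R *\<^sub>R One) (2 * R)) \<longrightarrow>
        (\<forall>x\<in>ball 0 R. \<eta> \<le> v x)"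
      by (elim exE conjE)
    have "(SUP x\<in>ball 0 R. u x)
        \<le> (1 - \<eta>) * M + \<eta> * m + 1 / \<kappa> * R\<^sup>2 * (SUP x\<in>ball 0 (k * R). \<bar>f x\<bar>)"
      if R: "R > 0" and \<epsilon>: "0 < \<epsilon>" "\<epsilon> < 1 / B * R" and adm: "admissible_family \<Lambda> \<nu>"
        and f: "bounded (f ` ball 0 (k * R))"
        and u: "bounded (range u)" "u \<in> borel_measurable borel"
        and sub: "\<forall>x\<in>ball 0 (k * R). u x \<le> \<alpha> * (\<integral>z. u (x + \<epsilon> *\<^sub>R z) \<partial>\<nu> x)
               + \<beta> / measure lborel (ball (0 :: real ^ 'n) \<epsilon>) * (LINT y:ball x \<epsilon>|lborel. u y) + \<epsilon>\<^sup>2 * f x"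
        and uM: "\<forall>x\<in>ball 0 (k * R). u x \<le> M"
        and level: "\<theta> * measure lborel (ball (0 :: real ^ 'n) R) \<le> measure lborel (ball 0 R \<inter> {x. u x \<le> m})"
      for R \<epsilon> m M and \<nu> :: "real ^ 'n \<Rightarrow> (real ^ 'n) measure" and f u :: "real ^ 'n \<Rightarrow> real"
    proof -
      note u(2)[measurable]
      define F where "F = (SUP x\<in>ball 0 (k * R). \<bar>f x\<bar>)"
      have kR: "R \<le> k * R" "0 < k * R" using R k by auto
      have bdd: "bdd_above ((\<lambda>x. \<bar>f x\<bar>) ` ball 0 (k * R))"
        using f by (auto simp: bounded_iff bdd_above_def)
      have fF: "\<bar>f x\<bar> \<le> F" if "x \<in> ball 0 (k * R)" for x
        unfolding F_def using bdd that by (rule cSUP_upper2) simp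
      have F: "0 \<le> F" using fF[of 0] kR by simp
      have "u x \<le> (1 - \<eta>) * M + \<eta> * m + 1 / \<kappa> * R\<^sup>2 * F" if x: "x \<in> ball 0 R" for x :: "real ^ 'n"
      \<comment> \<open>If the error term dominates \<eta> * (M - m), then u \<le> M already
        suffices; this covers M \<le> m as well. Otherwise M - m is positive and the normalised
        error is small enough for \<open>weak_harnack\<close>.\<close>
      proof (cases "\<eta> * (M - m) \<le> 1 / \<kappa> * R\<^sup>2 * F")
        case True
        then have "M \<le> (1 - \<eta>) * M + \<eta> * m + 1 / \<kappa> * R\<^sup>2 * F" by (simp add: algebra_simps)
        moreover have "u x \<le> M" using uM x kR by simp
        ultimately show ?thesis by simp
      next
        case False
        have err: "0 \<le> 1 / \<kappa> * R\<^sup>2 * F" using \<kappa> F by simp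
        then have "0 < \<eta> * (M - m)" using False by linarith
        then have mM: "0 < M - m" using \<eta> by (simp add: zero_less_mult_iff)
        define R' where "R' = R / \<epsilon>"
        have R': "0 < R'" "B \<le> R'" using R \<epsilon> B by (auto simp: R'_def field_simps)
        define v where "v x = (M - u (\<epsilon> *\<^sub>R x)) / (M - m)" for x
        have [measurable]: "v \<in> borel_measurable borel" unfolding v_def by measurable
        define g where "g = \<epsilon>\<^sup>2 * F / (M - m)"
        have cen: "centred \<Lambda> (\<nu> x)" for x
          using adm by (auto simp: admissible_family_def intro: symmetric_prob_measures_centred)
        have scaled: "\<epsilon> *\<^sub>R x \<in> ball 0 (k * R)" if "x \<in> ball 0 (14 * N * R')" for x :: "real ^ 'n"
        proof -
          have "norm x < 14 * N * R'" using that by (simp only: mem_ball_0)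
          then have "\<epsilon> * norm x < \<epsilon> * (14 * N * R')" using \<epsilon> by simp
          also have "\<dots> = k * R" using \<epsilon> by (simp add: R'_def k_def)
          finally show ?thesis using \<epsilon> unfolding mem_ball_0 by (simp only: norm_scaleR abs_of_pos)
        qed
        have "\<eta> \<le> v ((1 / \<epsilon>) *\<^sub>R x)"
        proof (rule bound[rule_format, where \<nu>="\<lambda>x. \<nu> (\<epsilon> *\<^sub>R x)" and g=g])
          \<comment> \<open>The failure of the first case, multiplied by \<epsilon>^2 / ((M - m) *
            R^2), is precisely the required bound on g at the rescaled radius.\<close>
          have "R\<^sup>2 * F \<le> \<kappa> * \<eta> * (M - m)" using False \<kappa> by (simp add: field_simps)
          then have "\<epsilon>\<^sup>2 / ((M - m) * R\<^sup>2) * (R\<^sup>2 * F) \<le> \<epsilon>\<^sup>2 / ((M - m) * R\<^sup>2) * (\<kappa> * \<eta> * (M - m))"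
            using mM by (intro mult_left_mono) auto
          then show "g \<le> \<kappa> * \<eta> / R'\<^sup>2"
            using mM R by (simp add: g_def R'_def power_divide mult_ac)
          show "0 \<le> v x" if "x \<in> ball 0 (14 * N * R')" for x :: "real ^ 'n"
            using scaled[OF that] uM mM by (simp add: v_def)
          show "supersolution (1 - \<beta>) \<beta> (\<lambda>x. \<nu> (\<epsilon> *\<^sub>R x)) g (ball 0 (14 * N * R')) v"
            unfolding supersolution_def
          proof (intro conjI ballI)
            obtain b where "\<And>x. \<bar>u x\<bar> \<le> b" using u(1) by (auto simp: bounded_iff)
            then have "\<bar>v x\<bar> \<le> (\<bar>M\<bar> + b) / (M - m)" for x
              using mM abs_triangle_ineq4[of M "u (\<epsilon> *\<^sub>R x)"]
              by (auto simp: v_def intro!: divide_right_mono order_trans[OF abs_triangle_ineq4])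
            then show "bounded (range v)" by (auto simp: bounded_iff)
          next
            fix x :: "real ^ 'n" assume x: "x \<in> ball 0 (14 * N * R')"
            define X where "X = \<epsilon> *\<^sub>R x"
            have int_v: "(\<integral>z. v (x + z) \<partial>\<mu>) = (M - (\<integral>z. u (X + \<epsilon> *\<^sub>R z) \<partial>\<mu>)) / (M - m)"
              if \<mu>: "centred \<Lambda> \<mu>" for \<mu>
            proof -
              interpret prob_space \<mu> using \<mu> by (simp add: centred_def)
              obtain b where "\<And>x. \<bar>u x\<bar> \<le> b" using u(1) by (auto simp: bounded_iff)
              then have "integrable \<mu> (\<lambda>z. u (X + \<epsilon> *\<^sub>R z))"
                by (intro centred_integrable[OF \<mu>, where B=b]) auto
              then show ?thesis
                by (simp add: v_def X_def scaleR_add_right prob_space)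
            qed
            have "u X \<le> (1 - \<beta>) * (\<integral>z. u (X + \<epsilon> *\<^sub>R z) \<partial>\<nu> X) + \<beta> * (\<integral>z. u (X + \<epsilon> *\<^sub>R z) \<partial>unif) + \<epsilon>\<^sup>2 * F"
            proof -
              have "X \<in> ball 0 (k * R)" using scaled[OF x] by (simp add: X_def)
              moreover from this have "\<epsilon>\<^sup>2 * f X \<le> \<epsilon>\<^sup>2 * F"
                using fF[of X] by (intro mult_left_mono) auto
              ultimately show ?thesis
                using sub assms(4) average_eq_integral_unif[OF u(2) \<epsilon>(1), of X, symmetric] by fastforce
            qed
            then have "(1 - \<beta>) * (M - (\<integral>z. u (X + \<epsilon> *\<^sub>R z) \<partial>\<nu> X)) + \<beta> * (M - (\<integral>z. u (X + \<epsilon> *\<^sub>R z) \<partial>unif)) - \<epsilon>\<^sup>2 * F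
                \<le> M - u X"
              by (simp add: algebra_simps)
            then have "((1 - \<beta>) * (M - (\<integral>z. u (X + \<epsilon> *\<^sub>R z) \<partial>\<nu> X)) + \<beta> * (M - (\<integral>z. u (X + \<epsilon> *\<^sub>R z) \<partial>unif)) - \<epsilon>\<^sup>2 * F)
                / (M - m) \<le> (M - u X) / (M - m)"
              using mM by (intro divide_right_mono) auto
            moreover have split_frac: "(p * q + p' * q' - e) / d = p * (q / d) + p' * (q' / d) - e / d" for p q p' q' e d :: real
              by (simp add: add_divide_distrib diff_divide_distrib[of "p * q + p' * q'"])
            ultimately show "(1 - \<beta>) * (\<integral>z. v (x + z) \<partial>\<nu> (\<epsilon> *\<^sub>R x)) + \<beta> * (\<integral>z. v (x + z) \<partial>unif) - g \<le> v x"
              unfolding int_v[OF cen] int_v[OF centred_unif[OF assms(1)]]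
              unfolding g_def v_def X_def[symmetric]
              by (simp only: split_frac)
          qed simp
          have "\<theta> * \<omega> / 2 ^ N * (2 * R') ^ N = \<theta> * measure lborel (ball (0 :: real ^ 'n) R) / \<epsilon> ^ N"
            using R content_ball_conv_unit_ball[of R "0 :: real ^ 'n"]
            by (simp add: \<omega>_def N_def R'_def power_divide power_mult_distrib)
          also have "\<dots> \<le> measure lborel (ball 0 R \<inter> {x. u x \<le> m}) / \<epsilon> ^ N"
            using level \<epsilon> by (intro divide_right_mono) auto
          also have "\<dots> = measure lborel ((*\<^sub>R) \<epsilon> -` (ball 0 R \<inter> {x. u x \<le> m}))"
            using \<epsilon> by (subst measure_lborel_vimage_scaleR[OF _ \<epsilon>(1)]) (auto simp: N_def)
          also have "\<dots> \<le> measure lborel ({x. 1 \<le> v x} \<inter> cube (- R' *\<^sub>R One) (2 * R'))"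
          proof (rule measure_mono_fmeasurable)
            show "{x. 1 \<le> v x} \<inter> cube (- R' *\<^sub>R One) (2 * R') \<in> fmeasurable lborel"
              by (rule fmeasurableI2[OF cube_fmeasurable]) auto
            have "(*\<^sub>R) \<epsilon> -` ball 0 R \<subseteq> ball (0 :: real ^ 'n) R'"
              unfolding subset_iff vimage_eq mem_ball_0 norm_scaleR using \<epsilon> by (simp add: R'_def field_simps)
            also have "\<dots> \<subseteq> cube (- R' *\<^sub>R One) (2 * R')"
              using ball_subset_cube[of "- R' *\<^sub>R One" "2 * R'"] by simp
            finally show "(*\<^sub>R) \<epsilon> -` (ball 0 R \<inter> {x. u x \<le> m}) \<subseteq> {x. 1 \<le> v x} \<inter> cube (- R' *\<^sub>R One) (2 * R')"
              using mM by (auto simp: v_def)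
            show "(*\<^sub>R) \<epsilon> -` (ball 0 R \<inter> {x. u x \<le> m}) \<in> sets lborel"
              using measurable_sets_borel[of "(*\<^sub>R) \<epsilon>" borel "ball 0 R \<inter> {x. u x \<le> m}"] by simp
          qed
          finally show "\<theta> * \<omega> / 2 ^ N * (2 * R') ^ N \<le> measure lborel ({x. 1 \<le> v x} \<inter> cube (- R' *\<^sub>R One) (2 * R'))" .
          show "(1 / \<epsilon>) *\<^sub>R x \<in> ball 0 R'"
            using x \<epsilon> unfolding mem_ball_0 norm_scaleR by (simp add: R'_def field_simps)
        qed (use cen R' in auto)
        then have "\<eta> * (M - m) \<le> M - u x"
          using mM \<epsilon> by (simp add: v_def field_simps)
        then show ?thesis using err by (simp add: algebra_simps)
      qed
      then show ?thesis
        unfolding F_def using R by (intro cSUP_least) auto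
    qed
    then show "\<exists>\<eta>>0. \<forall>(R::real) (\<epsilon>::real) (m::real) (M::real)
      (\<nu> :: real ^ 'n \<Rightarrow> (real ^ 'n) measure) (f :: real ^ 'n \<Rightarrow> real) (u :: real ^ 'n \<Rightarrow> real).
      R > 0 \<longrightarrow> 0 < \<epsilon> \<longrightarrow> \<epsilon> < 1 / B * R \<longrightarrow>
      admissible_family \<Lambda> \<nu> \<longrightarrow>
      bounded (f ` ball 0 (k * R)) \<longrightarrow>
      f \<in> borel_measurable (restrict_space borel (ball 0 (k * R))) \<longrightarrow>
      bounded (range u) \<longrightarrow> u \<in> borel_measurable borel \<longrightarrow>
      (\<forall>x\<in>ball 0 (k * R).
         u x \<le> \<alpha> * (\<integral>z. u (x + \<epsilon> *\<^sub>R z) \<partial>\<nu> x)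
               + \<beta> / measure lborel (ball (0 :: real ^ 'n) \<epsilon>) * (LINT y:ball x \<epsilon>|lborel. u y)
               + \<epsilon>\<^sup>2 * f x) \<longrightarrow>
      (\<forall>x\<in>ball 0 (k * R). u x \<le> M) \<longrightarrow>
      measure lborel (ball 0 R \<inter> {x. u x \<le> m}) \<ge> \<theta> * measure lborel (ball (0 :: real ^ 'n) R) \<longrightarrow>
      (SUP x\<in>ball 0 R. u x)
        \<le> (1 - \<eta>) * M + \<eta> * m + 1 / \<kappa> * R\<^sup>2 * (SUP x\<in>ball 0 (k * R). \<bar>f x\<bar>)"
      using \<eta> by (intro exI[of _ \<eta>] conjI allI impI) blast+
  qed
qed

end
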